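(* Let $(e^{tA})_{t\ge 0}$ be a $C_0$-semigroup on a complex Banach lattice $E$ with $s(A)>-\infty$. If $(e^{tA})_{t\ge 0}$ has the LEP property with respect to an increasing sequence $(P_n)_{n\in\mathbb{N}}$ of positive operators on $E$ converging strongly to the identity, and the rescaled semigroup $(e^{t(A-s(A))})_{t\ge 0}$ has relatively compact orbits, then the peripheral point spectrum of $A$ is cyclic.
   Context: A complex Banach lattice $E$ is the complexification of a real Banach lattice $E_{\mathbb{R}}$; $E_+$ is the positive cone of $E_{\mathbb{R}}$. A linear operator $T$ on $E$ is positive if $T(E_+)\subseteq E_+$. A sequence $(P_n)$ of positive operators is increasing if $P_{n+1}-P_n$ is positive for all $n$. The semigroup has the LEP property with respect to $(P_n)$ if for every $n\in\mathbb{N}$ and $f\in E_+\setminus\{0\}$ there exists $\tau>0$ (depending on $n$ and $f$) such that $P_ne^{tA}f\ge 0$ for all $t\ge\tau$. The orbit of $x\in E$ under a semigroup $(T_t)_{t\ge0}$ is $\{T_tx:t\ge 0\}$. The spectral bound is $s(A)=\sup\{\operatorname{Re}\lambda:\lambda\in\sigma(A)\}$, with $s(A)=-\infty$ if $\sigma(A)=\emptyset$. The peripheral point spectrum of $A$ is $\sigma_p(A)\cap\{\lambda\in\mathbb{C}:\operatorname{Re}\lambda=s(A)\}$, where $\sigma_p(A)$ is the point spectrum. A subset $S\subset\mathbb{C}$ is cyclic if whenever $a+ib\in S$ with $a,b\in\mathbb{R}$, then $a+inb\in S$ for all $n\in\mathbb{Z}$. *)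

theory Defs
  imports "HOL-Analysis.Analysis" "HOL-Library.Lattice_Algebras"
begin

section \<open>Real Banach lattices\<close>

text \<open>
  The absolute value is the lattice one: \<open>lattice_ab_group_add_abs\<close> postulates
  \<open>\<bar>x\<bar> = sup x (- x)\<close>.
\<close>

class banach_lattice = banach + ordered_real_vector + lattice_ab_group_add_abs +
  assumes norm_le_of_abs_le: "\<bar>x\<bar> \<le> \<bar>y\<bar> \<Longrightarrow> norm x \<le> norm y"

instance real :: banach_lattice
  by standard simp

lemma norm_abs_banach_lattice [simp]: "norm \<bar>x :: 'a :: banach_lattice\<bar> = norm x"
  by (rule order.antisym; rule norm_le_of_abs_le; simp)

lemma norm_mono_banach_lattice:
  fixes x y :: "'a :: banach_lattice"
  assumes "0 \<le> x" "x \<le> y"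
  shows "norm x \<le> norm y"
  using assms by (intro norm_le_of_abs_le) simp

lemma scaleR_le_abs:
  fixes x :: "'a :: banach_lattice"
  shows "c *\<^sub>R x \<le> \<bar>c\<bar> *\<^sub>R \<bar>x\<bar>"
proof (cases "c \<ge> 0")
  case True
  then show ?thesis by (simp add: scaleR_left_mono abs_ge_self)
next
  case False
  have "(- c) *\<^sub>R (- x) \<le> (- c) *\<^sub>R \<bar>x\<bar>"
    using False by (intro scaleR_left_mono) (auto simp: abs_ge_minus_self)
  then show ?thesis using False by simp
qed

lemma nonneg_limit:
  fixes X :: "nat \<Rightarrow> 'a :: banach_lattice"
  assumes lim: "X \<longlonglongrightarrow> x" and nonneg: "\<And>n. 0 \<le> X n"
  shows "0 \<le> x"
proof -
  have "norm (pprt (- x)) \<le> norm (X n - x)" for n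
  proof -
    have "- x \<le> X n - x" using nonneg[of n] by simp
    also have "\<dots> \<le> \<bar>X n - x\<bar>" by (rule abs_ge_self)
    finally have "pprt (- x) \<le> \<bar>X n - x\<bar>" by (simp add: pprt_def)
    then have "norm (pprt (- x)) \<le> norm \<bar>X n - x\<bar>"
      by (intro norm_mono_banach_lattice) simp_all
    then show ?thesis by simp
  qed
  moreover have "(\<lambda>n. norm (X n - x)) \<longlonglongrightarrow> 0"
    using lim by (simp add: LIM_zero_iff tendsto_norm_zero)
  ultimately have "norm (pprt (- x)) \<le> 0"
    by (meson LIMSEQ_le_const)
  then have "pprt (- x) = 0" by simp
  then show ?thesis by (simp add: le_zero_iff_zero_pprt[symmetric])
qed

lemma le_limit:
  fixes X Y :: "nat \<Rightarrow> 'a :: banach_lattice"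
  assumes "X \<longlonglongrightarrow> x" "Y \<longlonglongrightarrow> y" "\<And>n. X n \<le> Y n"
  shows "x \<le> y"
  using nonneg_limit[OF tendsto_diff[OF assms(2,1)]] assms(3) by simp


section \<open>Complexification\<close>

text \<open>\<open>Cpx x y\<close> stands for \<open>x + i y\<close>.\<close>

datatype 'a complexification = Cpx (re_part: 'a) (im_part: 'a)

lemma complexification_eq_iff:
  "z = w \<longleftrightarrow> re_part z = re_part w \<and> im_part z = im_part w"
  by (cases z; cases w) simp

instantiation complexification :: (real_vector) real_vector
begin

definition zero_complexification where "0 = Cpx 0 0"

definition plus_complexification where
  "z + w = Cpx (re_part z + re_part w) (im_part z + im_part w)"

definition uminus_complexification where
  "- z = Cpx (- re_part z) (- im_part z)"

definition minus_complexification where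
  "z - w = Cpx (re_part z - re_part w) (im_part z - im_part w)"

definition scaleR_complexification where
  "r *\<^sub>R z = Cpx (r *\<^sub>R re_part z) (r *\<^sub>R im_part z)"

instance
  by standard
    (simp_all add: complexification_eq_iff zero_complexification_def plus_complexification_def
      uminus_complexification_def minus_complexification_def scaleR_complexification_def
      algebra_simps)

end

lemma complexification_part_simps [simp]:
  "re_part 0 = 0" "im_part 0 = 0"
  "re_part (z + w) = re_part z + re_part w" "im_part (z + w) = im_part z + im_part w"
  "re_part (- z) = - re_part z" "im_part (- z) = - im_part z"
  "re_part (z - w) = re_part z - re_part w" "im_part (z - w) = im_part z - im_part w"
  "re_part (r *\<^sub>R z) = r *\<^sub>R re_part z" "im_part (r *\<^sub>R z) = r *\<^sub>R im_part z"
  by (simp_all add: zero_complexification_def plus_complexification_def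
      uminus_complexification_def minus_complexification_def scaleR_complexification_def)

definition scaleC :: "complex \<Rightarrow> 'a :: real_vector complexification \<Rightarrow> 'a complexification"
    (infixr \<open>*\<^sub>C\<close> 75) where
  "c *\<^sub>C z = Cpx (Re c *\<^sub>R re_part z - Im c *\<^sub>R im_part z)
                (Re c *\<^sub>R im_part z + Im c *\<^sub>R re_part z)"

lemma scaleC_part_simps [simp]:
  "re_part (c *\<^sub>C z) = Re c *\<^sub>R re_part z - Im c *\<^sub>R im_part z"
  "im_part (c *\<^sub>C z) = Re c *\<^sub>R im_part z + Im c *\<^sub>R re_part z"
  by (simp_all add: scaleC_def)

lemma vector_space_scaleC: "vector_space scaleC"
  by standard (simp_all add: complexification_eq_iff algebra_simps)

lemma scaleC_of_real [simp]: "complex_of_real r *\<^sub>C z = r *\<^sub>R z"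
  by (simp add: complexification_eq_iff)

text \<open>
  The modulus of \<open>z = x + i y\<close> is \<open>sup {cos \<theta> x + sin \<theta> y | \<theta>}\<close>. A Banach lattice need not be
  order complete; that this particular supremum exists is lemma \<open>modulus_exists\<close>.
\<close>

definition rot :: "'a :: real_vector complexification \<Rightarrow> real \<Rightarrow> 'a" where
  "rot z \<theta> = cos \<theta> *\<^sub>R re_part z + sin \<theta> *\<^sub>R im_part z"

definition modulus :: "'a :: banach_lattice complexification \<Rightarrow> 'a" where
  "modulus z = (LEAST u. \<forall>\<theta>. rot z \<theta> \<le> u)"

lemma abs_cos_diff_le: "\<bar>cos a - cos b\<bar> \<le> \<bar>a - b :: real\<bar>"
proof -
  have "norm (cos a - cos b) \<le> 1 * norm (a - b)"
    by (rule field_differentiable_bound[of UNIV cos "\<lambda>x. - sin x"])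
      (auto intro!: derivative_eq_intros)
  then show ?thesis by simp
qed

lemma abs_sin_diff_le: "\<bar>sin a - sin b\<bar> \<le> \<bar>a - b :: real\<bar>"
proof -
  have "norm (sin a - sin b) \<le> 1 * norm (a - b)"
    by (rule field_differentiable_bound[of UNIV sin cos])
      (auto intro!: derivative_eq_intros)
  then show ?thesis by simp
qed

lemma rot_le_rot:
  fixes z :: "'a :: banach_lattice complexification"
  shows "rot z a \<le> rot z b + \<bar>a - b\<bar> *\<^sub>R (\<bar>re_part z\<bar> + \<bar>im_part z\<bar>)"
proof -
  have "(cos a - cos b) *\<^sub>R re_part z \<le> \<bar>a - b\<bar> *\<^sub>R \<bar>re_part z\<bar>"
    using scaleR_le_abs scaleR_right_mono[OF abs_cos_diff_le abs_ge_zero] order_trans by blast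
  moreover have "(sin a - sin b) *\<^sub>R im_part z \<le> \<bar>a - b\<bar> *\<^sub>R \<bar>im_part z\<bar>"
    using scaleR_le_abs scaleR_right_mono[OF abs_sin_diff_le abs_ge_zero] order_trans by blast
  ultimately have "(cos a - cos b) *\<^sub>R re_part z + (sin a - sin b) *\<^sub>R im_part z
      \<le> \<bar>a - b\<bar> *\<^sub>R \<bar>re_part z\<bar> + \<bar>a - b\<bar> *\<^sub>R \<bar>im_part z\<bar>"
    by (rule add_mono)
  then show ?thesis by (simp add: rot_def algebra_simps)
qed

lemma rot_period: "\<exists>\<theta>'. 0 \<le> \<theta>' \<and> \<theta>' < 2 * pi \<and> rot z \<theta> = rot z \<theta>'"
proof -
  have "(cos \<theta>)\<^sup>2 + (sin \<theta>)\<^sup>2 = 1" by simp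
  then obtain t where "0 \<le> t" "t < 2 * pi" "cos \<theta> = cos t" "sin \<theta> = sin t"
    using sincos_total_2pi by metis
  then show ?thesis by (auto simp: rot_def)
qed

lemma modulus_exists:
  fixes z :: "'a :: banach_lattice complexification"
  shows "\<exists>u. (\<forall>\<theta>. rot z \<theta> \<le> u) \<and> (\<forall>v. (\<forall>\<theta>. rot z \<theta> \<le> v) \<longrightarrow> u \<le> v)"
proof -
  define w where "w = \<bar>re_part z\<bar> + \<bar>im_part z\<bar>"
  define \<delta> where "\<delta> n = inverse (real (Suc n))" for n
  define G where "G n = (\<lambda>k. rot z (\<delta> n * real k)) ` {..7 * Suc n}" for n
  define F where "F n = Sup_fin (G n)" for n
  have fin: "finite (G n)" "G n \<noteq> {}" for n by (auto simp: G_def)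
  have w: "0 \<le> w" by (simp add: w_def)
  have upper: "rot z \<theta> \<le> F n + \<delta> n *\<^sub>R w" for \<theta> n
  proof -
    obtain t where t: "0 \<le> t" "t < 2 * pi" "rot z \<theta> = rot z t" using rot_period by blast
    define k where "k = nat \<lfloor>t * real (Suc n)\<rfloor>"
    have k: "real k \<le> t * real (Suc n)" "t * real (Suc n) < real k + 1"
      using t(1) unfolding k_def by (simp_all add: of_nat_nat)
    have "t \<le> 7" using t(2) pi_less_4 pi_approx by simp
    then have "t * real (Suc n) \<le> 7 * real (Suc n)" by (intro mult_right_mono) simp_all
    then have "real k \<le> real (7 * Suc n)" using k(1) by simp
    then have "k \<le> 7 * Suc n" by (simp only: of_nat_le_iff)
    then have "rot z (\<delta> n * real k) \<in> G n" unfolding G_def by blast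
    then have le: "rot z (\<delta> n * real k) \<le> F n"
      unfolding F_def using fin by (intro Sup_fin.coboundedI)
    have "t - \<delta> n * real k = \<delta> n * (t * real (Suc n) - real k)"
      by (simp add: \<delta>_def field_simps del: of_nat_Suc)
    moreover have "\<bar>\<dots>\<bar> \<le> \<delta> n * 1"
      unfolding abs_mult using k by (intro mult_mono) (auto simp: \<delta>_def simp del: of_nat_Suc)
    ultimately have "\<bar>t - \<delta> n * real k\<bar> \<le> \<delta> n" by simp
    then have "\<bar>t - \<delta> n * real k\<bar> *\<^sub>R w \<le> \<delta> n *\<^sub>R w" using w by (rule scaleR_right_mono)
    then show ?thesis
      using rot_le_rot[of z t "\<delta> n * real k"] le unfolding t(3) w_def[symmetric]
      by (meson add_mono order_trans)
  qed
  have lower: "F n \<le> v" if "\<And>\<theta>. rot z \<theta> \<le> v" for v n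
    unfolding F_def using fin that by (intro Sup_fin.boundedI) (auto simp: G_def)
  have FF: "F n \<le> F m + \<delta> m *\<^sub>R w" for n m using lower upper by blast
  have \<delta>0: "0 \<le> \<delta> n" for n by (simp add: \<delta>_def)
  have diff: "norm (F n - F m) \<le> (\<delta> n + \<delta> m) * norm w" for n m
  proof -
    have "0 \<le> \<delta> n *\<^sub>R w" "0 \<le> \<delta> m *\<^sub>R w" using \<delta>0 w by (simp_all add: scaleR_nonneg_nonneg)
    moreover have "F n - F m \<le> \<delta> m *\<^sub>R w" "- (F n - F m) \<le> \<delta> n *\<^sub>R w"
      using FF[of n m] FF[of m n] by (simp_all add: algebra_simps)
    ultimately have "\<bar>F n - F m\<bar> \<le> (\<delta> n + \<delta> m) *\<^sub>R w"
      unfolding scaleR_add_left by (intro abs_leI) (meson add_increasing add_increasing2 order_trans)+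
    then have "norm \<bar>F n - F m\<bar> \<le> norm ((\<delta> n + \<delta> m) *\<^sub>R w)"
      by (intro norm_mono_banach_lattice) simp_all
    then show ?thesis using \<delta>0[of n] \<delta>0[of m] by simp
  qed
  have \<delta>_lim: "\<delta> \<longlonglongrightarrow> 0" unfolding \<delta>_def by (rule LIMSEQ_inverse_real_of_nat)
  have "Cauchy F"
  proof (rule metric_CauchyI)
    fix e :: real assume e: "0 < e"
    have "(\<lambda>n. \<delta> n * norm w) \<longlonglongrightarrow> 0"
      using tendsto_mult_right[OF \<delta>_lim, of "norm w"] by simp
    then have "\<forall>\<^sub>F n in sequentially. \<delta> n * norm w < e / 2"
      by (rule order_tendstoD(2)) (use e in simp)
    then obtain N where N: "\<And>n. n \<ge> N \<Longrightarrow> \<delta> n * norm w < e / 2"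
      by (auto simp: eventually_sequentially)
    show "\<exists>M. \<forall>m\<ge>M. \<forall>n\<ge>M. dist (F m) (F n) < e"
    proof (intro exI[of _ N] allI impI)
      fix m n assume "N \<le> m" "N \<le> n"
      then show "dist (F m) (F n) < e"
        using N[of m] N[of n] diff[of m n] by (simp add: dist_norm algebra_simps)
    qed
  qed
  then obtain u where u: "F \<longlonglongrightarrow> u" using Cauchy_convergent convergent_def by blast
  have u': "(\<lambda>n. F n + \<delta> n *\<^sub>R w) \<longlonglongrightarrow> u"
    using tendsto_add[OF u tendsto_scaleR[OF \<delta>_lim tendsto_const[of w]]] by simp
  have "rot z \<theta> \<le> u" for \<theta>
    by (rule le_limit[OF tendsto_const u']) (rule upper)
  moreover have "u \<le> v" if "\<forall>\<theta>. rot z \<theta> \<le> v" for v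
    by (rule le_limit[OF u tendsto_const]) (use that lower in blast)
  ultimately show ?thesis by blast
qed

lemma rot_le_modulus: "rot z \<theta> \<le> modulus z"
  and modulus_least: "(\<And>\<theta>. rot z \<theta> \<le> v) \<Longrightarrow> modulus z \<le> v"
proof -
  obtain u where u: "\<forall>\<theta>. rot z \<theta> \<le> u" "\<And>v. (\<forall>\<theta>. rot z \<theta> \<le> v) \<Longrightarrow> u \<le> v"
    using modulus_exists[of z] by blast
  have "modulus z = u" unfolding modulus_def by (rule Least_equality) (use u in auto)
  then show "rot z \<theta> \<le> modulus z" "(\<And>\<theta>. rot z \<theta> \<le> v) \<Longrightarrow> modulus z \<le> v" using u by auto
qed

lemma abs_re_part_le_modulus: "\<bar>re_part z\<bar> \<le> modulus z"
  using rot_le_modulus[of z 0] rot_le_modulus[of z pi] by (intro abs_leI) (simp_all add: rot_def)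

lemma abs_im_part_le_modulus: "\<bar>im_part z\<bar> \<le> modulus z"
  using rot_le_modulus[of z "pi / 2"] rot_le_modulus[of z "- (pi / 2)"]
  by (intro abs_leI) (simp_all add: rot_def)

lemma modulus_nonneg [simp]: "0 \<le> modulus z"
  using abs_re_part_le_modulus abs_ge_zero order_trans by blast

lemma modulus_zero [simp]: "modulus 0 = 0"
  by (rule order.antisym[OF modulus_least modulus_nonneg]) (simp add: rot_def)

lemma modulus_eq_0_iff [simp]: "modulus z = 0 \<longleftrightarrow> z = 0"
proof
  assume "modulus z = 0"
  then show "z = 0"
    using abs_re_part_le_modulus[of z] abs_im_part_le_modulus[of z]
    by (simp add: complexification_eq_iff)
qed simp

lemma modulus_triangle: "modulus (z + w) \<le> modulus z + modulus w"
proof (rule modulus_least)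
  fix \<theta>
  have "rot (z + w) \<theta> = rot z \<theta> + rot w \<theta>" by (simp add: rot_def algebra_simps)
  also have "\<dots> \<le> modulus z + modulus w" by (intro add_mono rot_le_modulus)
  finally show "rot (z + w) \<theta> \<le> modulus z + modulus w" .
qed

lemma modulus_le_abs: "modulus z \<le> \<bar>re_part z\<bar> + \<bar>im_part z\<bar>"
proof (rule modulus_least)
  fix \<theta>
  have "cos \<theta> *\<^sub>R re_part z \<le> 1 *\<^sub>R \<bar>re_part z\<bar>" "sin \<theta> *\<^sub>R im_part z \<le> 1 *\<^sub>R \<bar>im_part z\<bar>"
    by (rule order_trans[OF scaleR_le_abs scaleR_right_mono[OF _ abs_ge_zero]], simp)+
  then show "rot z \<theta> \<le> \<bar>re_part z\<bar> + \<bar>im_part z\<bar>"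
    unfolding rot_def by (metis add_mono scaleR_one)
qed

lemma modulus_Cpx_real: "modulus (Cpx x 0) = \<bar>x\<bar>"
  using modulus_le_abs[of "Cpx x 0"] abs_re_part_le_modulus[of "Cpx x 0"] by simp

lemma modulus_scaleC_le: "modulus (c *\<^sub>C z) \<le> cmod c *\<^sub>R modulus z"
proof (rule modulus_least)
  fix \<theta>
  have c: "Re c = cmod c * cos (Arg c)" "Im c = cmod c * sin (Arg c)"
    using rcis_cmod_Arg[of c] by (metis Re_rcis, metis Im_rcis rcis_cmod_Arg)
  have "rot (c *\<^sub>C z) \<theta> = cmod c *\<^sub>R rot z (\<theta> - Arg c)"
    by (simp add: rot_def c cos_diff sin_diff algebra_simps)
  also have "\<dots> \<le> cmod c *\<^sub>R modulus z"
    by (intro scaleR_left_mono rot_le_modulus) simp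
  finally show "rot (c *\<^sub>C z) \<theta> \<le> cmod c *\<^sub>R modulus z" .
qed

lemma modulus_scaleC: "modulus (c *\<^sub>C z) = cmod c *\<^sub>R modulus z"
proof (cases "c = 0")
  case True
  then show ?thesis
    using modulus_scaleC_le[of c z] order.antisym[OF _ modulus_nonneg] by fastforce
next
  case False
  interpret vector_space "scaleC :: complex \<Rightarrow> 'a complexification \<Rightarrow> 'a complexification"
    by (rule vector_space_scaleC)
  have "modulus z = modulus (inverse c *\<^sub>C (c *\<^sub>C z))" using False by simp
  also have "\<dots> \<le> cmod (inverse c) *\<^sub>R modulus (c *\<^sub>C z)" by (rule modulus_scaleC_le)
  finally have "cmod c *\<^sub>R modulus z \<le> cmod c *\<^sub>R (cmod (inverse c) *\<^sub>R modulus (c *\<^sub>C z))"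
    by (rule scaleR_left_mono) simp
  then have "cmod c *\<^sub>R modulus z \<le> modulus (c *\<^sub>C z)" using False by (simp add: norm_inverse)
  then show ?thesis using modulus_scaleC_le[of c z] by (rule order.antisym[rotated])
qed

instantiation complexification :: (banach_lattice) real_normed_vector
begin

definition norm_complexification where "norm z = norm (modulus z)"

definition sgn_complexification where "sgn (z :: 'a complexification) = inverse (norm z) *\<^sub>R z"

definition dist_complexification where "dist (z :: 'a complexification) w = norm (z - w)"

definition uniformity_complexification where
  "(uniformity :: ('a complexification \<times> 'a complexification) filter) =
    (INF e\<in>{0<..}. principal {(z, w). dist z w < e})"

definition open_complexification where
  "open (U :: 'a complexification set) \<longleftrightarrow>
    (\<forall>z\<in>U. eventually (\<lambda>(z', w). z' = z \<longrightarrow> w \<in> U) uniformity)"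

instance
proof
  fix z w :: "'a complexification" and r :: real
  show "norm (z + w) \<le> norm z + norm w"
    using norm_mono_banach_lattice[OF modulus_nonneg modulus_triangle[of z w]]
      norm_triangle_ineq[of "modulus z" "modulus w"]
    by (simp add: norm_complexification_def)
  show "norm (r *\<^sub>R z) = \<bar>r\<bar> * norm z"
    using modulus_scaleC[of "complex_of_real r" z] by (simp add: norm_complexification_def)
qed (simp_all add: norm_complexification_def dist_complexification_def sgn_complexification_def
    uniformity_complexification_def open_complexification_def)

end

lemma norm_scaleC: "norm (c *\<^sub>C z) = cmod c * norm z"
  for z :: "'a :: banach_lattice complexification"
  by (simp add: norm_complexification_def modulus_scaleC)

lemma norm_re_part_le: "norm (re_part z) \<le> norm z"
  for z :: "'a :: banach_lattice complexification"
  using norm_mono_banach_lattice[OF abs_ge_zero abs_re_part_le_modulus[of z]]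
  by (simp add: norm_complexification_def)

lemma norm_im_part_le: "norm (im_part z) \<le> norm z"
  for z :: "'a :: banach_lattice complexification"
  using norm_mono_banach_lattice[OF abs_ge_zero abs_im_part_le_modulus[of z]]
  by (simp add: norm_complexification_def)

lemma norm_complexification_le: "norm z \<le> norm (re_part z) + norm (im_part z)"
  for z :: "'a :: banach_lattice complexification"
  using norm_mono_banach_lattice[OF modulus_nonneg modulus_le_abs[of z]]
    norm_triangle_ineq[of "\<bar>re_part z\<bar>" "\<bar>im_part z\<bar>"]
  by (simp add: norm_complexification_def)

instance complexification :: (banach_lattice) banach
proof
  fix X :: "nat \<Rightarrow> 'a complexification"
  assume X: "Cauchy X"
  have "Cauchy (\<lambda>n. re_part (X n))" "Cauchy (\<lambda>n. im_part (X n))"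
    using X norm_re_part_le norm_im_part_le unfolding Cauchy_iff
    by (metis complexification_part_simps(7) order_le_less_trans,
        metis complexification_part_simps(8) order_le_less_trans)
  then obtain x y where xy: "(\<lambda>n. re_part (X n)) \<longlonglongrightarrow> x" "(\<lambda>n. im_part (X n)) \<longlonglongrightarrow> y"
    using Cauchy_convergent convergent_def by metis
  have "(\<lambda>n. norm (re_part (X n) - x) + norm (im_part (X n) - y)) \<longlonglongrightarrow> 0"
    using tendsto_add[OF tendsto_norm[OF LIM_zero[OF xy(1)]] tendsto_norm[OF LIM_zero[OF xy(2)]]]
    by simp
  then have "(\<lambda>n. X n - Cpx x y) \<longlonglongrightarrow> 0"
    by (rule Lim_null_comparison[rotated])
      (use norm_complexification_le[of "X _ - Cpx x y"] in simp)
  then show "convergent X" using LIM_zero_iff convergent_def by blast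
qed

definition positive_cone :: "'a :: banach_lattice complexification set" where
  "positive_cone = {Cpx x 0 | x. 0 \<le> x}"


section \<open>Operators\<close>

definition clinear :: "('a :: banach_lattice complexification \<Rightarrow> 'a complexification) \<Rightarrow> bool" where
  "clinear T \<longleftrightarrow> Vector_Spaces.linear scaleC scaleC T"

definition bounded_clinear ::
    "('a :: banach_lattice complexification \<Rightarrow> 'a complexification) \<Rightarrow> bool" where
  "bounded_clinear T \<longleftrightarrow> clinear T \<and> (\<exists>K. \<forall>z. norm (T z) \<le> K * norm z)"

definition positive_operator ::
    "('a :: banach_lattice complexification \<Rightarrow> 'a complexification) \<Rightarrow> bool" where
  "positive_operator T \<longleftrightarrow> clinear T \<and> T ` positive_cone \<subseteq> positive_cone"

definition increasing_operators ::
    "(nat \<Rightarrow> 'a :: banach_lattice complexification \<Rightarrow> 'a complexification) \<Rightarrow> bool" where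
  "increasing_operators P \<longleftrightarrow> (\<forall>n. positive_operator (\<lambda>z. P (Suc n) z - P n z))"

text \<open>
  An unbounded operator is given by its domain \<open>D\<close> and a function \<open>A\<close>, of which only the
  values on \<open>D\<close> matter.
\<close>

definition resolvent_set ::
    "'a :: banach_lattice complexification set \<Rightarrow> ('a complexification \<Rightarrow> 'a complexification)
      \<Rightarrow> complex set" where
  "resolvent_set D A =
    {\<mu>. bij_betw (\<lambda>z. \<mu> *\<^sub>C z - A z) D UNIV \<and>
        bounded_clinear (inv_into D (\<lambda>z. \<mu> *\<^sub>C z - A z))}"

definition spectrum ::
    "'a :: banach_lattice complexification set \<Rightarrow> ('a complexification \<Rightarrow> 'a complexification)
      \<Rightarrow> complex set" where
  "spectrum D A = - resolvent_set D A"

definition point_spectrum ::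
    "'a :: banach_lattice complexification set \<Rightarrow> ('a complexification \<Rightarrow> 'a complexification)
      \<Rightarrow> complex set" where
  "point_spectrum D A = {\<mu>. \<exists>z\<in>D. z \<noteq> 0 \<and> A z = \<mu> *\<^sub>C z}"

text \<open>The supremum of the empty set in \<open>ereal\<close> is \<open>-\<infinity>\<close>.\<close>

definition spectral_bound ::
    "'a :: banach_lattice complexification set \<Rightarrow> ('a complexification \<Rightarrow> 'a complexification)
      \<Rightarrow> ereal" where
  "spectral_bound D A = (SUP \<mu>\<in>spectrum D A. ereal (Re \<mu>))"

definition peripheral_point_spectrum ::
    "'a :: banach_lattice complexification set \<Rightarrow> ('a complexification \<Rightarrow> 'a complexification)
      \<Rightarrow> complex set" where
  "peripheral_point_spectrum D A =
    point_spectrum D A \<inter> {\<mu>. ereal (Re \<mu>) = spectral_bound D A}"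

definition cyclic :: "complex set \<Rightarrow> bool" where
  "cyclic S \<longleftrightarrow> (\<forall>a b. Complex a b \<in> S \<longrightarrow> (\<forall>n :: int. Complex a (of_int n * b) \<in> S))"


section \<open>Semigroups\<close>

text \<open>A semigroup is a function on \<open>real\<close> of which only the values at \<open>t \<ge> 0\<close> matter.\<close>

definition C0_semigroup ::
    "(real \<Rightarrow> 'a :: banach_lattice complexification \<Rightarrow> 'a complexification) \<Rightarrow> bool" where
  "C0_semigroup T \<longleftrightarrow>
    (\<forall>t\<ge>0. bounded_clinear (T t)) \<and>
    (\<forall>z. T 0 z = z) \<and>
    (\<forall>s\<ge>0. \<forall>t\<ge>0. \<forall>z. T (s + t) z = T s (T t z)) \<and>
    (\<forall>z. continuous_on {0..} (\<lambda>t. T t z))"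

definition generator_domain ::
    "(real \<Rightarrow> 'a :: banach_lattice complexification \<Rightarrow> 'a complexification)
      \<Rightarrow> 'a complexification set" where
  "generator_domain T = {z. \<exists>w. ((\<lambda>t. (T t z - z) /\<^sub>R t) \<longlongrightarrow> w) (at_right 0)}"

definition generator ::
    "(real \<Rightarrow> 'a :: banach_lattice complexification \<Rightarrow> 'a complexification)
      \<Rightarrow> 'a complexification \<Rightarrow> 'a complexification" where
  "generator T z = Lim (at_right 0) (\<lambda>t. (T t z - z) /\<^sub>R t)"

definition LEP ::
    "(real \<Rightarrow> 'a :: banach_lattice complexification \<Rightarrow> 'a complexification)
      \<Rightarrow> (nat \<Rightarrow> 'a complexification \<Rightarrow> 'a complexification) \<Rightarrow> bool" where
  "LEP T P \<longleftrightarrow>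
    (\<forall>n. \<forall>f\<in>positive_cone - {0}. \<exists>\<tau>>0. \<forall>t\<ge>\<tau>. P n (T t f) \<in> positive_cone)"

definition rescaled_semigroup ::
    "real \<Rightarrow> (real \<Rightarrow> 'a :: banach_lattice complexification \<Rightarrow> 'a complexification)
      \<Rightarrow> real \<Rightarrow> 'a complexification \<Rightarrow> 'a complexification" where
  "rescaled_semigroup s T = (\<lambda>t z. exp (- (t * s)) *\<^sub>R T t z)"

definition orbit ::
    "(real \<Rightarrow> 'a :: banach_lattice complexification \<Rightarrow> 'a complexification)
      \<Rightarrow> 'a complexification \<Rightarrow> 'a complexification set" where
  "orbit T z = {T t z | t. 0 \<le> t}"

definition relatively_compact_orbits ::
    "(real \<Rightarrow> 'a :: banach_lattice complexification \<Rightarrow> 'a complexification) \<Rightarrow> bool" where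
  "relatively_compact_orbits T \<longleftrightarrow> (\<forall>z. compact (closure (orbit T z)))"

end

(*
  Limits of the rescaled semigroup along a filter tending to infinity are positive by LEP, even
  though the semigroup is not.  Taking such limits twice gives the Jacobs--de Leeuw--Glicksberg
  projection Q, and the semigroup extends on the range of Q to a positive group U that rotates
  the eigenvector z.  Real functions on the plane that are homogeneous of degree one and a
  difference of sublinear functions can be evaluated at z in any Banach lattice, as suprema of
  linear functionals; applied to r e^(i theta) |-> r e^(i n theta) and followed by Q this gives
  a vector that U multiplies by e^(i n b t).  If it vanished, comparing the suprema would give
  K Q|z| >= (K + 1) |z|, hence z = 0.
*)

theory Submission
  imports Defs
begin

section \<open>Angle multiplication and planar suprema\<close>

text \<open>The range of Q is a lattice only in its own order: its modulus is not that of the whole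
  space, and |z| need not be fixed by Q. Computations with z therefore take place in the whole
  lattice, where the action of U yields only inequalities; the group property reverses them, and
  equality appears after one more application of Q. Suprema of linear functionals suit this, because
  U permutes the values of the functionals at a rotated vector.

  The function Re (c e^(i n theta)), extended homogeneously, is in general not sublinear. For
  h(theta) = K |c| + Re (c e^(i n theta)) sublinearity amounts to h + h'' >= 0, which holds once K
  >= |n^2 - 1|; the added K |c| |z| is subtracted again afterwards. That h attains height K + 1 in
  any prescribed direction, for a suitable c of modulus one, is what rules out a vanishing
  vector.\<close>

definition pairing :: "complex \<Rightarrow> 'a :: real_vector complexification \<Rightarrow> 'a" where
  "pairing a z = Re a *\<^sub>R re_part z + Im a *\<^sub>R im_part z"

lemma pairing_add: "pairing (a + b) z = pairing a z + pairing b z"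
  by (simp add: pairing_def algebra_simps)

lemma pairing_scale: "pairing (of_real r * a) z = r *\<^sub>R pairing a z"
  by (simp add: pairing_def algebra_simps)

text \<open>\<open>a\<close> encodes the functional w |-> Re (cnj a * w) on the plane, so a factor
  on the vector moves to \<open>a\<close> as its conjugate. Rotations thereby act on index sets of
  functionals.\<close>

lemma pairing_scaleC: "pairing a (c *\<^sub>C z) = pairing (a * cnj c) z"
  by (simp add: pairing_def algebra_simps)

lemma pairing_cis: "pairing (cis \<theta>) z = rot z \<theta>"
  by (simp add: pairing_def rot_def)

lemma pairing_le_modulus:
  fixes z :: "'a :: banach_lattice complexification"
  shows "pairing a z \<le> cmod a *\<^sub>R modulus z"
proof -
  have "pairing a z = cmod a *\<^sub>R rot z (Arg a)"
    using pairing_scale[of "cmod a" "cis (Arg a)" z] rcis_cmod_Arg[of a]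
    by (simp add: pairing_cis rcis_def)
  then show ?thesis
    by (simp add: rot_le_modulus scaleR_left_mono)
qed

section \<open>Second-order estimates for multiple angles\<close>

lemma one_minus_cos_add_le:
  fixes a b :: real
  shows "1 - cos (a + b) \<le> 2 * (1 - cos a) + 2 * (1 - cos b)"
proof -
  have s: "1 - cos x = 2 * (sin (x / 2))\<^sup>2" for x :: real
    using cos_double_sin[of "x / 2"] by simp
  have "\<bar>sin (a/2) * cos (b/2)\<bar> \<le> \<bar>sin (a/2)\<bar>" "\<bar>cos (a/2) * sin (b/2)\<bar> \<le> \<bar>sin (b/2)\<bar>"
    by (simp_all add: abs_mult mult_left_le mult_left_le_one_le)
  then have "\<bar>sin (a/2 + b/2)\<bar> \<le> \<bar>sin (a/2)\<bar> + \<bar>sin (b/2)\<bar>"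
    unfolding sin_add by linarith
  then have "(sin (a/2 + b/2))\<^sup>2 \<le> (\<bar>sin (a/2)\<bar> + \<bar>sin (b/2)\<bar>)\<^sup>2"
    by (simp add: abs_le_square_iff[symmetric])
  also have "\<dots> \<le> 2 * (sin (a/2))\<^sup>2 + 2 * (sin (b/2))\<^sup>2"
    using sum_squares_bound[of "\<bar>sin (a/2)\<bar>" "\<bar>sin (b/2)\<bar>"] by (simp add: power2_sum)
  finally show ?thesis unfolding s by (simp add: add_divide_distrib)
qed

text \<open>Both left sides vanish at least to second order at every multiple of 2 pi, where
  \<open>1 - cos \<delta>\<close> vanishes exactly to second order. The bound later controls how far
  a wave of frequency \<open>n\<close> departs from its tangent functional.\<close>

lemma multiple_angle_bound_nat:
  "\<exists>K\<ge>0. \<forall>\<delta>::real. 1 - cos (real n * \<delta>) \<le> K * (1 - cos \<delta>) \<and>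
     \<bar>sin (real n * \<delta>) - real n * sin \<delta>\<bar> \<le> K * (1 - cos \<delta>)"
proof (induction n)
  case 0
  then show ?case by (intro exI[of _ 0]) simp
next
  case (Suc n)
  then obtain K where K: "K \<ge> 0"
    "\<And>\<delta>. 1 - cos (real n * \<delta>) \<le> K * (1 - cos \<delta>)"
    "\<And>\<delta>. \<bar>sin (real n * \<delta>) - real n * sin \<delta>\<bar> \<le> K * (1 - cos \<delta>)"
    by blast
  show ?case
  proof (intro exI[of _ "2 * K + 2"] conjI allI)
    show "2 * K + 2 \<ge> 0" using K(1) by simp
    fix \<delta> :: real
    have c: "0 \<le> 1 - cos \<delta>" by simp
    have arg: "real (Suc n) * \<delta> = real n * \<delta> + \<delta>" by (simp add: algebra_simps)
    show "1 - cos (real (Suc n) * \<delta>) \<le> (2 * K + 2) * (1 - cos \<delta>)"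
      using one_minus_cos_add_le[of "real n * \<delta>" \<delta>] K(2)[of \<delta>]
      unfolding arg by (simp add: algebra_simps)
    have "sin (real (Suc n) * \<delta>) - real (Suc n) * sin \<delta> =
        (sin (real n * \<delta>) - real n * sin \<delta>) - sin (real n * \<delta>) * (1 - cos \<delta>)
        - sin \<delta> * (1 - cos (real n * \<delta>))"
      unfolding arg sin_add by (simp add: algebra_simps)
    moreover have "\<bar>sin (real n * \<delta>) * (1 - cos \<delta>)\<bar> \<le> 1 * (1 - cos \<delta>)"
      unfolding abs_mult by (intro mult_mono) auto
    moreover have "\<bar>sin \<delta> * (1 - cos (real n * \<delta>))\<bar> \<le> 1 * (K * (1 - cos \<delta>))"
      unfolding abs_mult using K(2)[of \<delta>] by (intro mult_mono) auto
    ultimately show "\<bar>sin (real (Suc n) * \<delta>) - real (Suc n) * sin \<delta>\<bar> \<le> (2 * K + 2) * (1 - cos \<delta>)"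
      using K(3)[of \<delta>] c by (simp only: distrib_right mult.assoc)
  qed
qed

lemma multiple_angle_bound:
  fixes n :: int
  shows "\<exists>K\<ge>0. \<forall>\<delta>::real. 1 - cos (of_int n * \<delta>) \<le> K * (1 - cos \<delta>) \<and>
     \<bar>sin (of_int n * \<delta>) - of_int n * sin \<delta>\<bar> \<le> K * (1 - cos \<delta>)"
proof (cases "n \<ge> 0")
  case True
  then show ?thesis using multiple_angle_bound_nat[of "nat n"] by simp
next
  case False
  then have n: "real_of_int n = - real (nat (- n))" by simp
  show ?thesis using multiple_angle_bound_nat[of "nat (- n)"] unfolding n
    by (simp add: abs_minus_commute)
qed

section \<open>Sublinear functions of frequency n and their linear minorants\<close>

text \<open>
  \<open>\<theta> \<mapsto> K \<bar>c\<bar> + Re (c e\<^sup>i\<^sup>n\<^sup>\<theta>)\<close>, extended homogeneously to the plane, is sublinear for large \<open>K\<close>;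
  the set consists of the linear functionals below it, and \<open>frequency_tangent\<close> is the one that
  touches it at angle \<open>\<phi>\<close>.
\<close>

definition frequency_set :: "int \<Rightarrow> real \<Rightarrow> complex \<Rightarrow> complex set" where
  "frequency_set n K c =
    {a. \<forall>\<theta>. Re (cnj a * cis \<theta>) \<le> K * cmod c + Re (c * cis (of_int n * \<theta>))}"

definition frequency_tangent :: "int \<Rightarrow> real \<Rightarrow> real \<Rightarrow> complex \<Rightarrow> complex" where
  "frequency_tangent n K \<phi> c = cis \<phi> * Complex (K * cmod c + Re (c * cis (of_int n * \<phi>)))
     (- of_int n * Im (c * cis (of_int n * \<phi>)))"

text \<open>With h(theta) = K |c| + Re (c e^(i n theta)), the tangent is e^(i phi) (h(phi) + i
  h'(phi)), whose value at phi + delta is h(phi) cos delta + h'(phi) sin delta. Staying below h is a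
  second-order estimate in delta, in which the term K |c| (1 - cos delta) pays for the
  error.\<close>

lemma frequency_tangent_in_frequency_set:
  fixes n :: int
  shows "\<exists>K\<ge>0. \<forall>c \<phi>. frequency_tangent n K \<phi> c \<in> frequency_set n K c"
proof -
  obtain K where K: "K \<ge> 0"
    "\<And>\<delta>::real. 1 - cos (of_int n * \<delta>) \<le> K * (1 - cos \<delta>)"
    "\<And>\<delta>::real. \<bar>sin (of_int n * \<delta>) - of_int n * sin \<delta>\<bar> \<le> K * (1 - cos \<delta>)"
    using multiple_angle_bound[of n] by blast
  \<comment> \<open>In units of \<open>cmod c * (1 - cos \<delta>)\<close> the cosine error costs
    \<open>K + 1\<close> and the sine error \<open>K\<close>; their sum is the new constant.\<close>
  have "frequency_tangent n (2 * K + 1) \<phi> c \<in> frequency_set n (2 * K + 1) c" for c \<phi>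
    unfolding frequency_set_def
  proof (intro CollectI allI)
    fix \<theta> :: real
    define \<delta> where "\<delta> = \<theta> - \<phi>"
    define d where "d = c * cis (of_int n * \<phi>)"
    define p q where "p = Re d" and "q = Im d"
    have d: "cmod d = cmod c" by (simp add: d_def norm_mult)
    have pq: "\<bar>p\<bar> \<le> cmod c" "\<bar>q\<bar> \<le> cmod c"
      using abs_Re_le_cmod[of d] abs_Im_le_cmod[of d] by (simp_all add: p_def q_def d)
    have c: "0 \<le> 1 - cos \<delta>" by simp
    have "cis (of_int n * \<theta>) = cis (of_int n * \<phi>) * cis (of_int n * \<delta>)"
      by (simp add: cis_mult \<delta>_def algebra_simps)
    then have r: "Re (c * cis (of_int n * \<theta>)) = p * cos (of_int n * \<delta>) - q * sin (of_int n * \<delta>)"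
      by (simp add: p_def q_def d_def flip: mult.assoc)
    have e: "cnj (cis \<phi>) * cis \<theta> = cis \<delta>" by (simp add: cis_cnj cis_mult \<delta>_def)
    have "cnj (frequency_tangent n (2 * K + 1) \<phi> c) * cis \<theta> =
        (cnj (cis \<phi>) * cis \<theta>) * cnj (Complex ((2 * K + 1) * cmod c + p) (- of_int n * q))"
      by (simp only: frequency_tangent_def p_def q_def d_def complex_cnj_mult mult_ac)
    then have l: "Re (cnj (frequency_tangent n (2 * K + 1) \<phi> c) * cis \<theta>) =
        ((2 * K + 1) * cmod c + p) * cos \<delta> - of_int n * q * sin \<delta>"
      unfolding e by (simp add: algebra_simps)
    have "p * (cos \<delta> - cos (of_int n * \<delta>)) \<le> \<bar>p\<bar> * \<bar>cos \<delta> - cos (of_int n * \<delta>)\<bar>"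
      by (metis abs_ge_self abs_mult)
    also have "\<dots> \<le> cmod c * ((K + 1) * (1 - cos \<delta>))"
    proof (intro mult_mono pq(1))
      have "cos (of_int n * \<delta>) \<le> 1" by simp
      then show "\<bar>cos \<delta> - cos (of_int n * \<delta>)\<bar> \<le> (K + 1) * (1 - cos \<delta>)"
        using K(2)[of \<delta>] c mult_nonneg_nonneg[OF K(1) c]
        unfolding abs_le_iff distrib_right mult_1 by linarith
    qed auto
    finally have 1: "p * (cos \<delta> - cos (of_int n * \<delta>)) \<le> cmod c * ((K + 1) * (1 - cos \<delta>))" .
    have "q * (sin (of_int n * \<delta>) - of_int n * sin \<delta>)
        \<le> \<bar>q\<bar> * \<bar>sin (of_int n * \<delta>) - of_int n * sin \<delta>\<bar>"
      by (metis abs_ge_self abs_mult)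
    also have "\<dots> \<le> cmod c * (K * (1 - cos \<delta>))"
      by (intro mult_mono pq(2) K(3)) auto
    finally show "Re (cnj (frequency_tangent n (2 * K + 1) \<phi> c) * cis \<theta>)
        \<le> (2 * K + 1) * cmod c + Re (c * cis (of_int n * \<theta>))"
      unfolding l r using 1 by (simp add: algebra_simps)
  qed
  then show ?thesis using K(1) by (intro exI[of _ "2 * K + 1"]) simp
qed

lemma cmod_le_of_Re_le:
  assumes "\<And>\<theta>. Re (cnj a * cis \<theta>) \<le> r"
  shows "cmod a \<le> r"
proof -
  have "cnj a * cis (Arg a) = cnj a * (a / cmod a)" if "a \<noteq> 0"
    using that by (metis cis_Arg sgn_eq)
  moreover have "cnj a * (a / cmod a) = cmod a" if "a \<noteq> 0"
    using that by (simp add: complex_norm_square[symmetric] mult.commute power2_eq_square)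
  ultimately show ?thesis using assms[of "Arg a"] assms[of 0]
    by (cases "a = 0") auto
qed

lemma cmod_le_of_mem_frequency_set:
  assumes "a \<in> frequency_set n K c"
  shows "cmod a \<le> K * cmod c + cmod c"
proof (rule cmod_le_of_Re_le)
  fix \<theta>
  have "Re (c * cis (of_int n * \<theta>)) \<le> cmod c"
    using complex_Re_le_cmod[of "c * cis (of_int n * \<theta>)"] by (simp add: norm_mult)
  then show "Re (cnj a * cis \<theta>) \<le> K * cmod c + cmod c"
    using assms unfolding frequency_set_def by (smt (verit) mem_Collect_eq)
qed

text \<open>Substituting theta + alpha in the bound multiplies \<open>c\<close> by e^(i n alpha).
  Here a rotation of the vector turns into a rotation of \<open>c\<close> by \<open>n\<close> times
  the angle.\<close>

lemma frequency_set_rotate: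
  assumes "a \<in> frequency_set n K c"
  shows "a * cis (- \<alpha>) \<in> frequency_set n K (c * cis (of_int n * \<alpha>))"
  unfolding frequency_set_def
proof (intro CollectI allI)
  fix \<theta>
  have "cnj (a * cis (- \<alpha>)) * cis \<theta> = cnj a * cis (\<theta> + \<alpha>)"
    by (simp add: cis_cnj cis_mult algebra_simps)
  moreover have "c * cis (of_int n * \<alpha>) * cis (of_int n * \<theta>) = c * cis (of_int n * (\<theta> + \<alpha>))"
    by (simp add: cis_mult mult.assoc algebra_simps)
  moreover have "cmod (c * cis (of_int n * \<alpha>)) = cmod c" by (simp add: norm_mult)
  ultimately show "Re (cnj (a * cis (- \<alpha>)) * cis \<theta>)
      \<le> K * cmod (c * cis (of_int n * \<alpha>)) + Re (c * cis (of_int n * \<alpha>) * cis (of_int n * \<theta>))"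
    using assms unfolding frequency_set_def by (simp only: mem_Collect_eq)
qed

text \<open>
  A Banach lattice need not be order complete; the supremum exists because finite suprema over
  finer and finer nets of \<open>A\<close> form a Cauchy sequence.
\<close>

lemma planar_sup_exists:
  fixes z :: "'a :: banach_lattice complexification"
  assumes "bounded A" "A \<noteq> {}"
  shows "\<exists>u. (\<forall>a\<in>A. pairing a z \<le> u) \<and> (\<forall>v. (\<forall>a\<in>A. pairing a z \<le> v) \<longrightarrow> u \<le> v)"
proof -
  define w where "w = modulus z"
  define \<delta> where "\<delta> n = inverse (real (Suc n))" for n
  have net: "\<exists>B. finite B \<and> B \<subseteq> A \<and> B \<noteq> {} \<and> (\<forall>a\<in>A. \<exists>b\<in>B. dist b a < \<delta> n)" for n
  proof -
    have "0 < \<delta> n" by (simp add: \<delta>_def)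
    moreover have "compact (closure A)" using assms(1) by (simp add: compact_closure)
    moreover have "closure A \<subseteq> (\<Union>b\<in>A. ball b (\<delta> n))"
      using \<open>0 < \<delta> n\<close> by (auto simp: closure_approachable)
    ultimately obtain B where B: "finite B" "B \<subseteq> A" "closure A \<subseteq> (\<Union>b\<in>B. ball b (\<delta> n))"
      using compactE_image[of "closure A" A "\<lambda>b. ball b (\<delta> n)"] by (metis open_ball)
    moreover have "B \<noteq> {}" using B(3) assms(2) closure_subset[of A] by auto
    moreover have "\<forall>a\<in>A. \<exists>b\<in>B. dist b a < \<delta> n"
      using B(3) closure_subset[of A] by (auto simp: subset_iff)
    ultimately show ?thesis by blast
  qed
  then obtain B where B: "\<And>n. finite (B n)" "\<And>n. B n \<subseteq> A" "\<And>n. B n \<noteq> {}"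
    "\<And>n a. a \<in> A \<Longrightarrow> \<exists>b\<in>B n. dist b a < \<delta> n" by metis
  define F where "F n = Sup_fin ((\<lambda>a. pairing a z) ` B n)" for n
  have w: "0 \<le> w" by (simp add: w_def)
  have upper: "pairing a z \<le> F n + \<delta> n *\<^sub>R w" if a: "a \<in> A" for a n
  proof -
    obtain b where b: "b \<in> B n" "dist b a < \<delta> n" using B(4)[OF a] by blast
    have "pairing b z \<le> F n" unfolding F_def using B(1) b by (intro Sup_fin.coboundedI) auto
    moreover have "cmod (a - b) *\<^sub>R w \<le> \<delta> n *\<^sub>R w"
      using b(2) w by (intro scaleR_right_mono) (simp_all add: dist_norm norm_minus_commute)
    then have "pairing (a - b) z \<le> \<delta> n *\<^sub>R w"
      using pairing_le_modulus[of "a - b" z] unfolding w_def by (rule order_trans[rotated])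
    ultimately show ?thesis using pairing_add[of b "a - b" z] by (simp add: add_mono)
  qed
  have lower: "F n \<le> v" if "\<forall>a\<in>A. pairing a z \<le> v" for v n
    unfolding F_def using B(1-3) that by (intro Sup_fin.boundedI) blast+
  \<comment> \<open>The nets for different indices are unrelated, so \<open>F\<close> need not be
    monotone; comparing \<open>F n\<close> and \<open>F m\<close> in both orders takes the place of
    monotonicity.\<close>
  have FF: "F n \<le> F m + \<delta> m *\<^sub>R w" for n m using lower upper by blast
  have \<delta>0: "0 \<le> \<delta> n" for n by (simp add: \<delta>_def)
  have diff: "norm (F n - F m) \<le> (\<delta> n + \<delta> m) * norm w" for n m
  proof -
    have "0 \<le> \<delta> n *\<^sub>R w" "0 \<le> \<delta> m *\<^sub>R w" using \<delta>0 w by (simp_all add: scaleR_nonneg_nonneg)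
    moreover have "F n - F m \<le> \<delta> m *\<^sub>R w" "- (F n - F m) \<le> \<delta> n *\<^sub>R w"
      using FF[of n m] FF[of m n] by (simp_all add: algebra_simps)
    ultimately have "\<bar>F n - F m\<bar> \<le> (\<delta> n + \<delta> m) *\<^sub>R w"
      unfolding scaleR_add_left by (intro abs_leI) (meson add_increasing add_increasing2 order_trans)+
    then have "norm \<bar>F n - F m\<bar> \<le> norm ((\<delta> n + \<delta> m) *\<^sub>R w)"
      by (intro norm_mono_banach_lattice) simp_all
    then show ?thesis using \<delta>0[of n] \<delta>0[of m] by simp
  qed
  have \<delta>_lim: "\<delta> \<longlonglongrightarrow> 0" unfolding \<delta>_def by (rule LIMSEQ_inverse_real_of_nat)
  have "Cauchy F"
  proof (rule metric_CauchyI)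
    fix e :: real assume e: "0 < e"
    have "(\<lambda>n. \<delta> n * norm w) \<longlonglongrightarrow> 0"
      using tendsto_mult_right[OF \<delta>_lim, of "norm w"] by simp
    then have "\<forall>\<^sub>F n in sequentially. \<delta> n * norm w < e / 2"
      by (rule order_tendstoD(2)) (use e in simp)
    then obtain N where N: "\<And>n. n \<ge> N \<Longrightarrow> \<delta> n * norm w < e / 2"
      by (auto simp: eventually_sequentially)
    show "\<exists>M. \<forall>m\<ge>M. \<forall>n\<ge>M. dist (F m) (F n) < e"
    proof (intro exI[of _ N] allI impI)
      fix m n assume "N \<le> m" "N \<le> n"
      then show "dist (F m) (F n) < e"
        using N[of m] N[of n] diff[of m n] by (simp add: dist_norm algebra_simps)
    qed
  qed
  then obtain u where u: "F \<longlonglongrightarrow> u" using Cauchy_convergent convergent_def by blast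
  have u': "(\<lambda>n. F n + \<delta> n *\<^sub>R w) \<longlonglongrightarrow> u"
    using tendsto_add[OF u tendsto_scaleR[OF \<delta>_lim tendsto_const[of w]]] by simp
  have "pairing a z \<le> u" if "a \<in> A" for a
    by (rule le_limit[OF tendsto_const u']) (rule upper[OF that])
  moreover have "u \<le> v" if "\<forall>a\<in>A. pairing a z \<le> v" for v
    by (rule le_limit[OF u tendsto_const]) (rule lower[OF that])
  ultimately show ?thesis by blast
qed

section \<open>Homogeneous functions of an eigenvector\<close>

text \<open>For large \<open>K\<close>, this is the sublinear function r e^(i theta) |-> r (K |c| +
  Re (c e^(i n theta))) evaluated at \<open>z\<close> through its linear minorants. Inside
  \<open>frequency_calculus\<close> the set of minorants is nonempty and bounded, which makes
  \<open>LEAST\<close> meaningful.\<close>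

definition frequency_sup :: "int \<Rightarrow> real \<Rightarrow> complex \<Rightarrow> 'a :: banach_lattice complexification \<Rightarrow> 'a" where
  "frequency_sup n K c z = (LEAST u. \<forall>a\<in>frequency_set n K c. pairing a z \<le> u)"

locale frequency_calculus =
  fixes n :: int and K :: real
  assumes K_nonneg: "0 \<le> K"
    and tangent: "frequency_tangent n K \<phi> c \<in> frequency_set n K c"
begin

lemma frequency_sup_upper: "a \<in> frequency_set n K c \<Longrightarrow> pairing a z \<le> frequency_sup n K c z"
  and frequency_sup_least: "(\<And>a. a \<in> frequency_set n K c \<Longrightarrow> pairing a z \<le> v) \<Longrightarrow> frequency_sup n K c z \<le> v"
proof -
  have "bounded (frequency_set n K c)"
    by (rule boundedI[of _ "K * cmod c + cmod c"]) (rule cmod_le_of_mem_frequency_set)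
  moreover have "frequency_set n K c \<noteq> {}" using tangent by blast
  ultimately obtain u where u: "\<forall>a\<in>frequency_set n K c. pairing a z \<le> u"
      "\<And>v. \<forall>a\<in>frequency_set n K c. pairing a z \<le> v \<Longrightarrow> u \<le> v"
    using planar_sup_exists[of "frequency_set n K c" z] by blast
  have "frequency_sup n K c z = u"
    unfolding frequency_sup_def by (rule Least_equality) (use u in auto)
  then show "a \<in> frequency_set n K c \<Longrightarrow> pairing a z \<le> frequency_sup n K c z"
    "(\<And>a. a \<in> frequency_set n K c \<Longrightarrow> pairing a z \<le> v) \<Longrightarrow> frequency_sup n K c z \<le> v"
    using u by auto
qed

text \<open>The homogeneous function \<open>r e\<^sup>i\<^sup>\<theta> \<mapsto> r Re (c e\<^sup>i\<^sup>n\<^sup>\<theta>)\<close> of \<open>z\<close>, without any representation theorem.\<close>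

definition harmonic :: "complex \<Rightarrow> 'a :: banach_lattice complexification \<Rightarrow> 'a" where
  "harmonic c z = frequency_sup n K c z - (K * cmod c) *\<^sub>R modulus z"

text \<open>The oscillating parts cancel, so the three sublinear functions add up to kappa times the
  Euclidean norm, kappa = K (|a| + |b| + |c|). From above, minorants of the three add up to a
  functional of modulus at most kappa. From below, at each angle the three tangents add up to kappa
  e^(i phi), and \<open>modulus\<close> is the supremum over these directions. The symmetric form
  yields oddness and additivity at once.\<close>

lemma harmonic_sum_zero:
  assumes "a + b + c = 0"
  shows "harmonic a z + harmonic b z + harmonic c z = 0"
proof -
  define \<kappa> where "\<kappa> = K * cmod a + K * cmod b + K * cmod c"
  define S where "S = frequency_sup n K a z + frequency_sup n K b z + frequency_sup n K c z"
  have \<kappa>: "0 \<le> \<kappa>" using K_nonneg by (simp add: \<kappa>_def)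
  have "pairing p z + pairing q z + pairing r z \<le> \<kappa> *\<^sub>R modulus z"
    if "p \<in> frequency_set n K a" "q \<in> frequency_set n K b" "r \<in> frequency_set n K c" for p q r
  proof -
    have "cmod (p + q + r) \<le> \<kappa>"
    proof (rule cmod_le_of_Re_le)
      fix \<theta>
      have "Re (a * cis (of_int n * \<theta>)) + Re (b * cis (of_int n * \<theta>)) + Re (c * cis (of_int n * \<theta>))
          = Re ((a + b + c) * cis (of_int n * \<theta>))" by (simp only: distrib_right plus_complex.simps)
      moreover have "Re (cnj p * cis \<theta>) \<le> K * cmod a + Re (a * cis (of_int n * \<theta>))"
        "Re (cnj q * cis \<theta>) \<le> K * cmod b + Re (b * cis (of_int n * \<theta>))"
        "Re (cnj r * cis \<theta>) \<le> K * cmod c + Re (c * cis (of_int n * \<theta>))"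
        using that unfolding frequency_set_def by blast+
      ultimately show "Re (cnj (p + q + r) * cis \<theta>) \<le> \<kappa>"
        unfolding assms \<kappa>_def complex_cnj_add distrib_right plus_complex.simps by simp
    qed
    then have "cmod (p + q + r) *\<^sub>R modulus z \<le> \<kappa> *\<^sub>R modulus z"
      by (rule scaleR_right_mono) simp
    then show ?thesis
      using pairing_le_modulus[of "p + q + r" z] unfolding pairing_add by (rule order_trans[rotated])
  qed
  \<comment> \<open>Suprema are taken one variable at a time, with the other two terms kept on the
    right, because leastness is known only for a single \<open>frequency_sup\<close>.\<close>
  then have 1: "pairing p z \<le> \<kappa> *\<^sub>R modulus z - (pairing q z + pairing r z)"
    if "p \<in> frequency_set n K a" "q \<in> frequency_set n K b" "r \<in> frequency_set n K c" for p q r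
    using that unfolding le_diff_eq add.assoc[symmetric] by blast
  have 2: "frequency_sup n K a z \<le> \<kappa> *\<^sub>R modulus z - (pairing q z + pairing r z)"
    if "q \<in> frequency_set n K b" "r \<in> frequency_set n K c" for q r
    using that 1 by (intro frequency_sup_least)
  have 3: "pairing q z \<le> \<kappa> *\<^sub>R modulus z - (frequency_sup n K a z + pairing r z)"
    if "q \<in> frequency_set n K b" "r \<in> frequency_set n K c" for q r
    using 2[OF that] by (simp only: le_diff_eq ac_simps)
  have 4: "frequency_sup n K b z \<le> \<kappa> *\<^sub>R modulus z - (frequency_sup n K a z + pairing r z)"
    if "r \<in> frequency_set n K c" for r
    using that 3 by (intro frequency_sup_least)
  have "pairing r z \<le> \<kappa> *\<^sub>R modulus z - (frequency_sup n K a z + frequency_sup n K b z)"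
    if "r \<in> frequency_set n K c" for r
    using 4[OF that] by (simp only: le_diff_eq ac_simps)
  then have "frequency_sup n K c z \<le> \<kappa> *\<^sub>R modulus z - (frequency_sup n K a z + frequency_sup n K b z)"
    by (intro frequency_sup_least)
  then have upper: "S \<le> \<kappa> *\<^sub>R modulus z" by (simp add: S_def le_diff_eq algebra_simps)
  have tan: "\<kappa> *\<^sub>R rot z \<phi> \<le> S" for \<phi>
  proof -
    define e where "e = cis (of_int n * \<phi>)"
    have "Complex (K * cmod a + Re (a * e)) (- of_int n * Im (a * e)) +
        Complex (K * cmod b + Re (b * e)) (- of_int n * Im (b * e)) +
        Complex (K * cmod c + Re (c * e)) (- of_int n * Im (c * e))
      = Complex (\<kappa> + Re ((a + b + c) * e)) (- of_int n * Im ((a + b + c) * e))"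
      by (simp add: complex_eq_iff \<kappa>_def algebra_simps)
    also have "\<dots> = of_real \<kappa>" unfolding assms by (simp add: complex_eq_iff)
    finally have "frequency_tangent n K \<phi> a + frequency_tangent n K \<phi> b + frequency_tangent n K \<phi> c
        = cis \<phi> * of_real \<kappa>"
      unfolding frequency_tangent_def e_def[symmetric] by (simp only: distrib_left[symmetric])
    then have "pairing (frequency_tangent n K \<phi> a) z + pairing (frequency_tangent n K \<phi> b) z
        + pairing (frequency_tangent n K \<phi> c) z = \<kappa> *\<^sub>R rot z \<phi>"
      unfolding pairing_add[symmetric] by (simp only: mult.commute[of _ "of_real \<kappa>"] pairing_scale pairing_cis)
    then show ?thesis
      unfolding S_def by (metis (lifting) add_mono[OF add_mono] frequency_sup_upper[OF tangent])
  qed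
  have "\<kappa> *\<^sub>R modulus z \<le> S"
  proof (cases "\<kappa> = 0")
    case True
    then show ?thesis using tan[of 0] by simp
  next
    case False
    have "modulus z \<le> inverse \<kappa> *\<^sub>R S"
    proof (rule modulus_least)
      fix \<phi>
      have "inverse \<kappa> *\<^sub>R (\<kappa> *\<^sub>R rot z \<phi>) \<le> inverse \<kappa> *\<^sub>R S"
        using tan \<kappa> by (intro scaleR_left_mono) simp_all
      then show "rot z \<phi> \<le> inverse \<kappa> *\<^sub>R S" using False by simp
    qed
    then have "\<kappa> *\<^sub>R modulus z \<le> \<kappa> *\<^sub>R (inverse \<kappa> *\<^sub>R S)" using \<kappa> by (rule scaleR_left_mono)
    then show ?thesis using False by simp
  qed
  then have "S = \<kappa> *\<^sub>R modulus z" using upper by simp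
  then show ?thesis by (simp add: harmonic_def S_def \<kappa>_def algebra_simps)
qed

text \<open>Division by \<open>r\<close> carries the minorants for \<open>of_real r * c\<close> to
  those for \<open>c\<close>. The reverse inequality is the same one with \<open>inverse r\<close>,
  drawn in \<open>harmonic_scale\<close>.\<close>

lemma frequency_sup_scale_le:
  assumes "0 < r"
  shows "frequency_sup n K (of_real r * c) z \<le> r *\<^sub>R frequency_sup n K c z"
proof (rule frequency_sup_least)
  fix a assume a: "a \<in> frequency_set n K (of_real r * c)"
  define a' where "a' = a /\<^sub>R r"
  have a': "a = of_real r * a'" using assms by (simp add: a'_def scaleR_conv_of_real)
  have "a' \<in> frequency_set n K c"
    unfolding frequency_set_def
  proof (intro CollectI allI)
    fix \<theta>
    have "Re (cnj a * cis \<theta>) \<le> K * cmod (of_real r * c) + Re (of_real r * c * cis (of_int n * \<theta>))"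
      using a unfolding frequency_set_def by blast
    also have "\<dots> = r * (K * cmod c + Re (c * cis (of_int n * \<theta>)))"
      using assms by (simp add: norm_mult algebra_simps)
    also have "Re (cnj a * cis \<theta>) = r * Re (cnj a' * cis \<theta>)"
      unfolding a' by (simp add: algebra_simps)
    finally show "Re (cnj a' * cis \<theta>) \<le> K * cmod c + Re (c * cis (of_int n * \<theta>))"
      using assms by (simp only: mult_le_cancel_left_pos)
  qed
  then have "r *\<^sub>R pairing a' z \<le> r *\<^sub>R frequency_sup n K c z"
    using assms by (intro scaleR_left_mono frequency_sup_upper) simp_all
  then show "pairing a z \<le> r *\<^sub>R frequency_sup n K c z"
    by (simp add: a' pairing_scale)
qed

lemma harmonic_0 [simp]: "harmonic 0 z = 0"
proof -
  have "harmonic 0 z + harmonic 0 z + harmonic 0 z = (1 + 1 + 1 :: real) *\<^sub>R harmonic 0 z"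
    by (simp only: scaleR_left_distrib scaleR_one)
  then show ?thesis using harmonic_sum_zero[of 0 0 0 z] by simp
qed

lemma harmonic_minus: "harmonic (- c) z = - harmonic c z"
  using harmonic_sum_zero[of "c" "- c" 0 z] by (simp add: eq_neg_iff_add_eq_0 add.commute)

lemma harmonic_add: "harmonic (a + b) z = harmonic a z + harmonic b z"
  using harmonic_sum_zero[of a b "- (a + b)" z] by (simp add: harmonic_minus del: minus_add_distrib)

lemma harmonic_scale: "harmonic (of_real r * c) z = r *\<^sub>R harmonic c z"
proof -
  have pos: "harmonic (of_real r * c) z = r *\<^sub>R harmonic c z" if r: "0 < r" for r
  proof -
    have "r *\<^sub>R frequency_sup n K c z = r *\<^sub>R frequency_sup n K (of_real (inverse r) * (of_real r * c)) z"
      using r by (simp flip: mult.assoc of_real_mult)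
    also have "\<dots> \<le> r *\<^sub>R (inverse r *\<^sub>R frequency_sup n K (of_real r * c) z)"
      using r by (intro scaleR_left_mono frequency_sup_scale_le) simp_all
    finally have "frequency_sup n K (of_real r * c) z = r *\<^sub>R frequency_sup n K c z"
      using frequency_sup_scale_le[OF r, of c z] r by (intro order.antisym) simp_all
    then show ?thesis using r by (simp add: harmonic_def norm_mult algebra_simps)
  qed
  consider "r > 0" | "r = 0" | "- r > 0" by linarith
  then show ?thesis
  proof cases
    case 3
    then show ?thesis using pos[of "- r"] by (simp add: harmonic_minus)
  qed (simp_all add: pos)
qed

end

section \<open>Positive groups and vectors that they rotate\<close>

text \<open>
  \<open>u 0\<close> is the projection onto the range of the representation, which is a lattice in its own
  order but not a sublattice.
\<close>

locale positive_group =
  fixes u :: "real \<Rightarrow> 'a :: banach_lattice \<Rightarrow> 'a"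
  assumes add: "u t (x + y) = u t x + u t y"
    and scale: "u t (r *\<^sub>R x) = r *\<^sub>R u t x"
    and pos: "0 \<le> x \<Longrightarrow> 0 \<le> u t x"
    and group: "u s (u t x) = u (s + t) x"
begin

lemma minus: "u t (- x) = - u t x"
  using scale[of t "-1" x] by simp

lemma diff: "u t (x - y) = u t x - u t y"
  using add[of t x "- y"] minus[of t y] by simp

lemma mono: "x \<le> y \<Longrightarrow> u t x \<le> u t y"
  using pos[of "y - x" t] by (simp add: diff)

text \<open>Positivity allows \<open>u t\<close> to be applied to the second inequality and
  \<open>u 0\<close> to the first. The result has \<open>u 0 y\<close> instead of \<open>y\<close>,
  since \<open>y\<close> need not lie in the range of the projection.\<close>

lemma eq_of_forward_backward:
  assumes "y \<le> u t x" "x \<le> u (- t) y"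
  shows "u t x = u 0 y"
proof (rule order.antisym)
  show "u t x \<le> u 0 y" using mono[OF assms(2), of t] by (simp add: group)
  show "u 0 y \<le> u t x" using mono[OF assms(1), of 0] by (simp add: group)
qed

lemma pairing:
  assumes "\<And>t. Cpx (u t (re_part z)) (u t (im_part z)) = cis (b * t) *\<^sub>C z"
  shows "u t (pairing a z) = pairing (a * cis (- (b * t))) z"
proof -
  have "u t (pairing a z) = pairing a (Cpx (u t (re_part z)) (u t (im_part z)))"
    by (simp add: pairing_def add scale)
  then show ?thesis by (simp add: assms pairing_scaleC cis_cnj)
qed

text \<open>Each \<open>rot z \<theta>\<close> is the image under \<open>u t\<close> of another
  rotation of \<open>z\<close>, hence lies below \<open>u t (modulus z)\<close>. This holds for
  \<open>t\<close> and \<open>- t\<close> alike, so the forward and backward estimates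
  combine.\<close>

lemma modulus:
  assumes z: "\<And>t. Cpx (u t (re_part z)) (u t (im_part z)) = cis (b * t) *\<^sub>C z"
  shows "u t (modulus z) = u 0 (modulus z)"
proof (rule eq_of_forward_backward)
  have "modulus z \<le> u t (modulus z)" for t
  proof (rule modulus_least)
    fix \<theta>
    have "rot z \<theta> = u t (pairing (cis (\<theta> + b * t)) z)"
      by (simp add: pairing[OF z] cis_mult) (simp add: pairing_cis)
    also have "\<dots> \<le> u t (modulus z)"
      by (intro mono) (simp add: pairing_cis rot_le_modulus)
    finally show "rot z \<theta> \<le> u t (modulus z)" .
  qed
  then show "modulus z \<le> u t (modulus z)" "modulus z \<le> u (- t) (modulus z)" by auto
qed

text \<open>\<open>u t\<close> carries the functionals for \<open>c\<close> to those for
  \<open>c * cis (of_int n * b * t)\<close>, so \<open>harmonic\<close> follows the law of frequency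
  n b after projection. As \<open>harmonic\<close> is real linear in \<open>c\<close>, its values at
  1 and i carry all of it.\<close>

theorem eigenvector_power:
  fixes n :: int
  assumes z: "\<And>t. Cpx (u t (re_part z)) (u t (im_part z)) = cis (b * t) *\<^sub>C z" and "z \<noteq> 0"
  shows "\<exists>w. w \<noteq> 0 \<and>
    (\<forall>t. Cpx (u t (re_part w)) (u t (im_part w)) = cis (of_int n * b * t) *\<^sub>C w)"
proof -
  obtain K where K: "K \<ge> 0" "\<And>c \<phi>. frequency_tangent n K \<phi> c \<in> frequency_set n K c"
    using frequency_tangent_in_frequency_set by blast
  interpret frequency_calculus n K by standard (use K in auto)
  have sup_le: "frequency_sup n K (c * cis (of_int n * b * t)) z \<le> u t (frequency_sup n K c z)" for c t
  proof (rule frequency_sup_least)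
    fix a assume "a \<in> frequency_set n K (c * cis (of_int n * b * t))"
    from frequency_set_rotate[OF this, of "- (b * t)"]
    have "a * cis (b * t) \<in> frequency_set n K c"
      by (simp add: mult.assoc cis_mult)
    then have "u t (pairing (a * cis (b * t)) z) \<le> u t (frequency_sup n K c z)"
      by (intro mono frequency_sup_upper)
    then show "pairing a z \<le> u t (frequency_sup n K c z)"
      by (simp add: pairing[OF z] mult.assoc cis_mult)
  qed
  have sup_eq: "u t (frequency_sup n K c z) = u 0 (frequency_sup n K (c * cis (of_int n * b * t)) z)" for c t
  proof (rule eq_of_forward_backward[OF sup_le])
    show "frequency_sup n K c z \<le> u (- t) (frequency_sup n K (c * cis (of_int n * b * t)) z)"
      using sup_le[of "c * cis (of_int n * b * t)" "- t"] by (simp add: mult.assoc cis_mult)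
  qed
  have harmonic_eq: "u t (harmonic c z) = u 0 (harmonic (c * cis (of_int n * b * t)) z)" for c t
    by (simp add: harmonic_def diff scale sup_eq[of t c] modulus[OF z, of t] norm_mult)
  \<comment> \<open>Re (c e^(i n theta)) is cos (n theta) for c = 1 and - sin (n theta) for c = i;
    the minus sign makes \<open>w\<close> the counterpart of r e^(i n theta).\<close>
  define w where "w = Cpx (u 0 (harmonic 1 z)) (- u 0 (harmonic \<i> z))"
  have expand: "harmonic c z = Re c *\<^sub>R harmonic 1 z + Im c *\<^sub>R harmonic \<i> z" for c
  proof -
    have "of_real (Re c) * 1 + of_real (Im c) * \<i> = c" by (simp add: complex_eq_iff)
    then show ?thesis
      using harmonic_add[of "of_real (Re c) * 1" "of_real (Im c) * \<i>" z]
      unfolding harmonic_scale by simp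
  qed
  have "Cpx (u t (re_part w)) (u t (im_part w)) = cis (of_int n * b * t) *\<^sub>C w" for t
  proof -
    define e where "e = cis (of_int n * b * t)"
    have "u t (re_part w) = u 0 (harmonic e z)" "u t (im_part w) = - u 0 (harmonic (\<i> * e) z)"
      by (simp_all add: w_def group minus harmonic_eq[of t] e_def)
    then show ?thesis
      unfolding e_def[symmetric]
      by (simp add: expand[of e] expand[of "\<i> * e"] w_def complexification_eq_iff add diff scale minus)
  qed
  moreover have "w \<noteq> 0"
  proof
    assume "w = 0"
    then have "u 0 (harmonic 1 z) = 0" "u 0 (harmonic \<i> z) = 0"
      by (simp_all add: w_def complexification_eq_iff)
    then have h0: "u 0 (harmonic c z) = 0" for c by (simp add: expand[of c] add scale)
    define m where "m = modulus z"
    have bound: "(K + 1) *\<^sub>R rot z \<phi> \<le> K *\<^sub>R u 0 m" for \<phi>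
    proof -
      \<comment> \<open>This \<open>c\<close> puts the crest of the wave at angle
        \<open>\<phi>\<close>: the slope is zero and the height is \<open>K + 1\<close>.\<close>
      define c where "c = cis (- (of_int n * \<phi>))"
      have "frequency_tangent n K \<phi> c = of_real (K + 1) * cis \<phi>"
        by (simp add: frequency_tangent_def c_def cis_mult complex_eq_iff)
      then have "u 0 ((K + 1) *\<^sub>R pairing (cis \<phi>) z) \<le> u 0 (frequency_sup n K c z)"
        using frequency_sup_upper[OF tangent[of \<phi> c], of z]
        by (intro mono) (simp only: pairing_scale)
      also have "\<dots> = K *\<^sub>R u 0 m"
        using h0[of c] by (simp add: harmonic_def diff scale c_def m_def)
      finally show ?thesis by (simp add: scale pairing[OF z]) (simp add: pairing_cis)
    qed
    have "m \<le> inverse (K + 1) *\<^sub>R (K *\<^sub>R u 0 m)"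
      unfolding m_def
    proof (rule modulus_least)
      fix \<phi>
      have "inverse (K + 1) *\<^sub>R ((K + 1) *\<^sub>R rot z \<phi>) \<le> inverse (K + 1) *\<^sub>R (K *\<^sub>R u 0 m)"
        using K(1) bound by (intro scaleR_left_mono) simp_all
      then show "rot z \<phi> \<le> inverse (K + 1) *\<^sub>R (K *\<^sub>R u 0 (modulus z))"
        using K(1) by (simp add: m_def)
    qed
    then have "(K + 1) *\<^sub>R m \<le> (K + 1) *\<^sub>R (inverse (K + 1) *\<^sub>R (K *\<^sub>R u 0 m))"
      using K(1) by (intro scaleR_left_mono) simp_all
    then have le: "(K + 1) *\<^sub>R m \<le> K *\<^sub>R u 0 m"
      using K(1) by (simp flip: mult.assoc)
    \<comment> \<open>Projecting \<open>le\<close> turns both sides into multiples of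
      \<open>u 0 m\<close> and forces \<open>u 0 m \<le> 0\<close>; put back into \<open>le\<close>,
      this leaves only \<open>m = 0\<close>.\<close>
    have "(K + 1) *\<^sub>R u 0 m \<le> K *\<^sub>R u 0 m" using mono[OF le, of 0] by (simp add: scale group)
    then have "u 0 m \<le> 0" by (simp add: scaleR_left_distrib)
    then have "K *\<^sub>R u 0 m \<le> 0" using K(1) by (simp add: scaleR_nonneg_nonpos)
    then have "K *\<^sub>R m + m \<le> 0" using le by (simp add: scaleR_left_distrib)
    moreover have "0 \<le> K *\<^sub>R m" "0 \<le> m" using K(1) by (simp_all add: m_def scaleR_nonneg_nonneg)
    then have "m \<le> K *\<^sub>R m + m" by simp
    ultimately have "m = 0" using \<open>0 \<le> m\<close> by (meson order.antisym order_trans)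
    then show False using \<open>z \<noteq> 0\<close> by (simp add: m_def)
  qed
  ultimately show ?thesis by blast
qed

end

section \<open>Bounded operators and filters\<close>

lemma clinear_iff:
  "clinear T \<longleftrightarrow> (\<forall>x y. T (x + y) = T x + T y) \<and> (\<forall>c x. T (c *\<^sub>C x) = c *\<^sub>C T x)"
  by (simp add: clinear_def Vector_Spaces.linear_iff vector_space_scaleC)

lemma clinear_add: "clinear T \<Longrightarrow> T (x + y) = T x + T y"
  and clinear_scaleC: "clinear T \<Longrightarrow> T (c *\<^sub>C x) = c *\<^sub>C T x"
  by (simp_all add: clinear_iff)

lemma clinear_scaleR: "clinear T \<Longrightarrow> T (r *\<^sub>R x) = r *\<^sub>R T x"
  using clinear_scaleC[of T "of_real r" x] by simp

lemma clinear_diff: "clinear T \<Longrightarrow> T (x - y) = T x - T y"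
  using clinear_add[of T "x - y" y] by simp

lemma clinear_zero: "clinear T \<Longrightarrow> T 0 = 0"
  using clinear_scaleR[of T 0 0] by simp

lemma clinear_bounded_linear:
  assumes "clinear T" "\<And>z. norm (T z) \<le> K * norm z"
  shows "bounded_linear T"
  by (rule bounded_linear_intro[of _ K]) (use assms in \<open>simp_all add: clinear_add clinear_scaleR mult.commute\<close>)

lemma bounded_bilinear_scaleC:
  "bounded_bilinear (scaleC :: complex \<Rightarrow> 'a :: banach_lattice complexification \<Rightarrow> 'a complexification)"
  by standard (auto simp: complexification_eq_iff algebra_simps norm_scaleC intro!: exI[of _ 1])

lemmas tendsto_scaleC = bounded_bilinear.tendsto[OF bounded_bilinear_scaleC]

lemma scaleC_scaleC: "a *\<^sub>C b *\<^sub>C z = (a * b) *\<^sub>C z"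
  and scaleC_one [simp]: "1 *\<^sub>C z = z"
  and scaleC_diff_right: "c *\<^sub>C (z - w) = c *\<^sub>C z - c *\<^sub>C w"
  and scaleC_diff_left: "(a - b) *\<^sub>C z = a *\<^sub>C z - b *\<^sub>C z"
  by (simp_all add: complexification_eq_iff algebra_simps)

lemma bounded_linear_re_part: "bounded_linear (re_part :: 'a :: banach_lattice complexification \<Rightarrow> 'a)"
  and bounded_linear_im_part: "bounded_linear (im_part :: 'a :: banach_lattice complexification \<Rightarrow> 'a)"
  by (rule bounded_linear_intro[of _ 1]; simp add: norm_re_part_le norm_im_part_le)+

section \<open>The positive cone and automatic continuity of positive operators\<close>

lemma mem_positive_cone_iff: "z \<in> positive_cone \<longleftrightarrow> im_part z = 0 \<and> 0 \<le> re_part z"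
  by (cases z) (auto simp: positive_cone_def)

lemma closed_positive_cone: "closed (positive_cone :: 'a :: banach_lattice complexification set)"
  unfolding closed_sequential_limits
proof (intro allI impI, elim conjE)
  fix X and z :: "'a complexification"
  assume X: "\<forall>n. X n \<in> positive_cone" and lim: "X \<longlonglongrightarrow> z"
  have "(\<lambda>n. im_part (X n)) \<longlonglongrightarrow> im_part z" "(\<lambda>n. re_part (X n)) \<longlonglongrightarrow> re_part z"
    using lim bounded_linear.tendsto[OF bounded_linear_im_part] bounded_linear.tendsto[OF bounded_linear_re_part]
    by blast+
  moreover have "im_part (X n) = 0" "0 \<le> re_part (X n)" for n
    using X by (simp_all add: mem_positive_cone_iff)
  ultimately show "z \<in> positive_cone"
    unfolding mem_positive_cone_iff using nonneg_limit LIMSEQ_const_iff[of 0 "im_part z"] by auto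
qed

text \<open>Without a bound on the cone, some summable series of positive vectors would have images
  of unbounded norm, although its sum dominates every term and \<open>p\<close> is monotone. The
  continuity of the \<open>P n\<close> comes from here, as \<open>positive_operator\<close> speaks
  only of order.\<close>

lemma positive_real_map_bounded:
  fixes p :: "'a :: banach_lattice \<Rightarrow> 'a"
  assumes add: "\<And>x y. p (x + y) = p x + p y" and scale: "\<And>r x. p (r *\<^sub>R x) = r *\<^sub>R p x"
    and pos: "\<And>x. 0 \<le> x \<Longrightarrow> 0 \<le> p x"
  shows "\<exists>K. \<forall>x. norm (p x) \<le> K * norm x"
proof -
  have diff: "p (x - y) = p x - p y" for x y using add[of "x - y" y] by simp
  have mono: "x \<le> y \<Longrightarrow> p x \<le> p y" for x y using pos[of "y - x"] by (simp add: diff)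
  have p0: "p 0 = 0" using scale[of 0 0] by simp
  have "\<exists>K. \<forall>x\<ge>0. norm (p x) \<le> K * norm x"
  proof (rule ccontr)
    assume "\<nexists>K. \<forall>x\<ge>0. norm (p x) \<le> K * norm x"
    \<comment> \<open>The factor \<open>4 ^ k\<close> is split in two: one \<open>2 ^ k\<close>
      makes the series summable, the other makes the images blow up.\<close>
    then have "\<exists>x\<ge>0. norm (p x) > 4 ^ k * norm x" for k :: nat
      by (meson not_le)
    then obtain x where x: "\<And>k. 0 \<le> x k" "\<And>k. norm (p (x k)) > 4 ^ k * norm (x k)" by metis
    have xpos: "norm (x k) > 0" for k using x(2)[of k] p0 by auto
    define y where "y k = inverse (2 ^ k * norm (x k)) *\<^sub>R x k" for k
    have y: "0 \<le> y k" "norm (y k) = (1 / 2) ^ k" for k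
      using x(1)[of k] xpos[of k] by (simp_all add: y_def scaleR_nonneg_nonneg field_simps power_divide)
    have py: "norm (p (y k)) > 2 ^ k" for k
    proof -
      have "(2::real) ^ k = inverse (2 ^ k * norm (x k)) * (4 ^ k * norm (x k))"
        using xpos[of k] by (simp add: field_simps flip: power_mult_distrib)
      also have "\<dots> < inverse (2 ^ k * norm (x k)) * norm (p (x k))"
        using x(2) xpos by (intro mult_strict_left_mono) simp_all
      also have "\<dots> = norm (p (y k))" by (simp add: y_def scale)
      finally show ?thesis .
    qed
    have "summable y"
      by (rule summable_norm_cancel) (simp add: y(2) summable_geometric)
    then have sums: "(\<lambda>n. \<Sum>k<n. y k) \<longlonglongrightarrow> suminf y" by (rule summable_LIMSEQ)
    have le: "y k \<le> suminf y" for k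
    proof (rule le_limit[OF tendsto_const LIMSEQ_ignore_initial_segment[OF sums, of "Suc k"]])
      fix n
      have "sum y {k} \<le> sum y {..<n + Suc k}" using y(1) by (intro sum_mono2) auto
      then show "y k \<le> sum y {..<n + Suc k}" by simp
    qed
    have "2 ^ k < norm (p (suminf y))" for k
    proof -
      have "norm (p (y k)) \<le> norm (p (suminf y))"
        using pos[OF y(1)] mono[OF le] by (rule norm_mono_banach_lattice)
      then show ?thesis using py[of k] by linarith
    qed
    moreover obtain k where "norm (p (suminf y)) < 2 ^ k"
      using real_arch_pow[of 2] by auto
    ultimately show False by (meson less_asym)
  qed
  then obtain K where K: "\<And>x. 0 \<le> x \<Longrightarrow> norm (p x) \<le> K * norm x" by blast
  have "norm (p x) \<le> K * norm x" for x
  proof -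
    have "\<bar>p x\<bar> \<le> p \<bar>x\<bar>"
      using mono[of x "\<bar>x\<bar>"] mono[of "- x" "\<bar>x\<bar>"] scale[of "-1" x]
      by (intro abs_leI) (simp_all add: abs_ge_self abs_ge_minus_self)
    then have "norm (p x) \<le> norm (p \<bar>x\<bar>)"
      using norm_mono_banach_lattice[OF abs_ge_zero] by fastforce
    then show ?thesis using K[of "\<bar>x\<bar>"] by simp
  qed
  then show ?thesis by blast
qed

lemma positive_operator_real:
  assumes "positive_operator T"
  shows "im_part (T (Cpx x 0)) = 0" and "0 \<le> x \<Longrightarrow> 0 \<le> re_part (T (Cpx x 0))"
proof -
  have lin: "clinear T" using assms by (simp add: positive_operator_def)
  have pos: "im_part (T (Cpx x 0)) = 0 \<and> 0 \<le> re_part (T (Cpx x 0))" if "0 \<le> x" for x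
  proof -
    have "T (Cpx x 0) \<in> positive_cone"
      using assms that by (force simp: positive_operator_def positive_cone_def)
    then show ?thesis by (simp add: mem_positive_cone_iff)
  qed
  then show "0 \<le> x \<Longrightarrow> 0 \<le> re_part (T (Cpx x 0))" by blast
  have "Cpx x 0 = Cpx (pprt x) 0 - Cpx (- nprt x) 0"
    using prts[of x] by (simp add: complexification_eq_iff)
  then have "T (Cpx x 0) = T (Cpx (pprt x) 0) - T (Cpx (- nprt x) 0)"
    using clinear_diff[OF lin] by metis
  then show "im_part (T (Cpx x 0)) = 0"
    using pos[of "pprt x"] pos[of "- nprt x"] by simp
qed

text \<open>A positive operator preserves the real space, so it is the complexification of its
  restriction. This transfers the limit operators to the real lattice, where
  \<open>positive_group\<close> lives.\<close>

lemma positive_operator_Cpx: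
  assumes "positive_operator T"
  shows "T (Cpx x y) = Cpx (re_part (T (Cpx x 0))) (re_part (T (Cpx y 0)))"
proof -
  have lin: "clinear T" using assms by (simp add: positive_operator_def)
  have "Cpx x y = Cpx x 0 + \<i> *\<^sub>C Cpx y 0" by (simp add: complexification_eq_iff)
  then have "T (Cpx x y) = T (Cpx x 0) + \<i> *\<^sub>C T (Cpx y 0)"
    by (simp add: clinear_add[OF lin] clinear_scaleC[OF lin])
  then show ?thesis
    by (simp add: complexification_eq_iff positive_operator_real[OF assms])
qed

lemma positive_operator_bounded_linear:
  assumes "positive_operator T"
  shows "bounded_linear T"
proof -
  have lin: "clinear T" using assms by (simp add: positive_operator_def)
  define p where "p x = re_part (T (Cpx x 0))" for x
  have "p (x + y) = p x + p y" for x y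
  proof -
    have "Cpx (x + y) 0 = Cpx x 0 + Cpx y 0" by (simp add: complexification_eq_iff)
    then show ?thesis by (simp add: p_def clinear_add[OF lin])
  qed
  moreover have "p (r *\<^sub>R x) = r *\<^sub>R p x" for r x
  proof -
    have "Cpx (r *\<^sub>R x) 0 = r *\<^sub>R Cpx x 0" by (simp add: complexification_eq_iff)
    then show ?thesis by (simp add: p_def clinear_scaleR[OF lin])
  qed
  ultimately obtain K where K: "\<And>x. norm (p x) \<le> K * norm x"
    using positive_real_map_bounded[of p] positive_operator_real(2)[OF assms] p_def by metis
  have "norm (T z) \<le> (\<bar>K\<bar> + \<bar>K\<bar>) * norm z" for z
  proof -
    have "norm (p x) \<le> \<bar>K\<bar> * norm z" if "norm x \<le> norm z" for x
      using K[of x] that by (meson abs_ge_self mult_mono abs_ge_zero norm_ge_zero order_trans)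
    then have "norm (p (re_part z)) \<le> \<bar>K\<bar> * norm z" "norm (p (im_part z)) \<le> \<bar>K\<bar> * norm z"
      using norm_re_part_le norm_im_part_le by blast+
    moreover have "T z = Cpx (p (re_part z)) (p (im_part z))"
      using positive_operator_Cpx[OF assms, of "re_part z" "im_part z"] by (simp add: p_def)
    ultimately show ?thesis
      using norm_complexification_le[of "T z"] by (simp add: distrib_right)
  qed
  then show ?thesis using clinear_bounded_linear[OF lin] by blast
qed

text \<open>Banach-Steinhaus by Baire category: the closed sets of vectors with bound
  \<open>n\<close> cover the space, so one of them contains a ball. \<open>I\<close> will be the
  half-line of times.\<close>

lemma uniform_boundedness:
  fixes S :: "'i \<Rightarrow> 'b :: banach \<Rightarrow> 'c :: real_normed_vector"
  assumes lin: "\<And>i. i \<in> I \<Longrightarrow> bounded_linear (S i)"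
    and bdd: "\<And>x. \<exists>B. \<forall>i\<in>I. norm (S i x) \<le> B"
  shows "\<exists>M\<ge>0. \<forall>i\<in>I. \<forall>x. norm (S i x) \<le> M * norm x"
proof -
  define G where "G n = {x. \<forall>i\<in>I. norm (S i x) \<le> real n}" for n
  have closed: "closed (G n)" for n
  proof -
    have "G n = (\<Inter>i\<in>I. {x. norm (S i x) \<le> real n})" by (auto simp: G_def)
    moreover have "closed {x. norm (S i x) \<le> real n}" if "i \<in> I" for i
      using lin[OF that]
      by (intro closed_Collect_le continuous_on_norm linear_continuous_on continuous_on_const)
    ultimately show ?thesis by (metis (no_types, lifting) closed_INT)
  qed
  have "(\<Union>n. G n) = UNIV"
  proof -
    have "\<exists>n. x \<in> G n" for x
    proof -
      obtain B where "\<forall>i\<in>I. norm (S i x) \<le> B" using bdd by blast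
      moreover obtain n where "B \<le> real n" using real_arch_simple by blast
      ultimately have "\<forall>i\<in>I. norm (S i x) \<le> real n" by force
      then show ?thesis by (auto simp: G_def)
    qed
    then show ?thesis by auto
  qed
  have "\<exists>n. interior (G n) \<noteq> {}"
  proof (rule ccontr)
    assume "\<nexists>n. interior (G n) \<noteq> {}"
    then have "euclidean interior_of (\<Union> (range G)) = {}"
      using closed by (intro Baire_category_alt) (auto simp: completely_metrizable_space_euclidean)
    then show False using \<open>(\<Union>n. G n) = UNIV\<close> by simp
  qed
  then obtain n x e where e: "e > 0" "ball x e \<subseteq> G n"
    by (metis ex_in_conv mem_interior)
  have "norm (S i v) \<le> (4 * real n / e) * norm v" if i: "i \<in> I" for i v
  proof (cases "v = 0")
    case True
    then show ?thesis using linear_simps(3)[OF lin[OF i]] by simp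
  next
    case False
    \<comment> \<open>Half the radius keeps \<open>x + r *\<^sub>R v\<close> inside the open ball;
      the difference of two values of norm at most \<open>n\<close> then gives the factor
      \<open>4 * real n / e\<close>.\<close>
    define r where "r = e / 2 / norm v"
    have r: "r > 0" using e False by (simp add: r_def)
    have "x \<in> G n" "x + r *\<^sub>R v \<in> G n"
      using e False by (auto simp: r_def dist_norm subset_iff)
    then have "norm (S i x) \<le> real n" "norm (S i (x + r *\<^sub>R v)) \<le> real n" using i by (auto simp: G_def)
    then have "norm (S i (x + r *\<^sub>R v) - S i x) \<le> 2 * real n"
      using norm_triangle_ineq4[of "S i (x + r *\<^sub>R v)" "S i x"] by linarith
    then have "r * norm (S i v) \<le> 2 * real n"
      using r by (simp add: linear_simps(1,5)[OF lin[OF i]])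
    then show ?thesis using r False e(1) by (simp add: r_def field_simps)
  qed
  then show ?thesis using e(1) by (intro exI[of _ "4 * real n / e"]) auto
qed

text \<open>Tychonoff's theorem in the product of the \<open>K v\<close> yields simultaneous convergence.\<close>

lemma simultaneously_convergent_subfilter:
  fixes f :: "'v \<Rightarrow> 'i \<Rightarrow> 'b :: topological_space"
  assumes F: "F \<noteq> bot" and K: "\<And>v. compact (K v)" "\<And>v i. f v i \<in> K v"
  shows "\<exists>G\<le>F. G \<noteq> bot \<and> (\<forall>v. \<exists>l\<in>K v. (f v \<longlongrightarrow> l) G)"
proof -
  define \<Phi> where "\<Phi> i = (\<lambda>v. f v i)" for i
  have "compact (PiE UNIV K)"
    using K(1) compactin_PiE[of "\<lambda>_ :: 'v. euclidean :: 'b topology" UNIV K]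
    by (simp add: euclidean_product_topology)
  moreover have "filtermap \<Phi> F \<noteq> bot" using F by (simp add: filtermap_bot_iff)
  moreover have "eventually (\<lambda>h. h \<in> PiE UNIV K) (filtermap \<Phi> F)"
    using K(2) by (simp add: eventually_filtermap \<Phi>_def PiE_iff)
  ultimately obtain g where g: "g \<in> PiE UNIV K" "inf (nhds g) (filtermap \<Phi> F) \<noteq> bot"
    unfolding compact_filter by blast
  \<comment> \<open>\<open>G\<close> refines \<open>F\<close> by the demand that
    \<open>\<Phi>\<close> be close to \<open>g\<close>; that \<open>G\<close> is a proper filter is
    exactly the cluster property of \<open>g\<close>.\<close>
  define G where "G = inf F (filtercomap \<Phi> (nhds g))"
  have "G \<noteq> bot"
  proof
    assume "G = bot"
    then obtain A B where AB: "eventually A F" "eventually B (nhds g)" "\<And>i. A i \<Longrightarrow> \<not> B (\<Phi> i)"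
      unfolding G_def trivial_limit_def eventually_inf eventually_filtercomap by blast
    have "eventually (\<lambda>h. \<not> B h) (filtermap \<Phi> F)"
      unfolding eventually_filtermap using AB(1,3) by (rule eventually_mono)
    then have "eventually (\<lambda>h. False) (inf (nhds g) (filtermap \<Phi> F))"
      using AB(2) unfolding eventually_inf by blast
    then show False using g(2) by (simp add: trivial_limit_def)
  qed
  moreover have "(f v \<longlongrightarrow> g v) G" for v
  proof -
    have "filterlim \<Phi> (nhds g) G"
      unfolding G_def filterlim_iff_le_filtercomap by simp
    show ?thesis
    proof (rule topological_tendstoI)
      fix U assume "open U" "g v \<in> U"
      moreover have "open ((\<lambda>h. h v) -` U)"
        using \<open>open U\<close> continuous_on_product_coordinates by (rule open_vimage)
      ultimately show "eventually (\<lambda>i. f v i \<in> U) G"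
        using topological_tendstoD[OF \<open>filterlim \<Phi> (nhds g) G\<close>, of "(\<lambda>h. h v) -` U"]
        by (simp add: \<Phi>_def)
    qed
  qed
  ultimately show ?thesis using g(1) by (intro exI[of _ G]) (auto simp: G_def)
qed

section \<open>The limit group\<close>

locale asymptotically_positive_semigroup =
  fixes S :: "real \<Rightarrow> 'a :: banach_lattice complexification \<Rightarrow> 'a complexification"
    and P :: "nat \<Rightarrow> 'a complexification \<Rightarrow> 'a complexification"
    and M :: real
  assumes lin: "0 \<le> t \<Longrightarrow> clinear (S t)"
    and S_0: "S 0 z = z"
    and S_add: "0 \<le> s \<Longrightarrow> 0 \<le> t \<Longrightarrow> S s (S t z) = S (s + t) z"
    and M_nonneg: "0 \<le> M"
    and norm_S: "0 \<le> t \<Longrightarrow> norm (S t z) \<le> M * norm z"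
    and compact_orbit: "compact (closure (orbit S z))"
    and P_pos: "positive_operator (P n)"
    and P_lim: "(\<lambda>n. P n z) \<longlonglongrightarrow> z"
    and LEP: "LEP S P"
begin

lemma bounded_linear_S: "0 \<le> t \<Longrightarrow> bounded_linear (S t)"
  using clinear_bounded_linear lin norm_S by blast

lemma norm_le_of_mem_closure_orbit:
  assumes "w \<in> closure (orbit S z)"
  shows "norm w \<le> M * norm z"
proof -
  have "closure (orbit S z) \<subseteq> cball 0 (M * norm z)"
    by (rule closure_minimal) (auto simp: orbit_def norm_S)
  then show ?thesis using assms by auto
qed

lemma norm_S_le_norm_S:
  assumes "0 \<le> k" "k \<le> t" shows "norm (S t z) \<le> M * norm (S k z)"
  using norm_S[of "t - k" "S k z"] S_add[of "t - k" k z] assms by simp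

text \<open>One filter serves all shifts \<open>k\<close> and vectors \<open>z\<close> together;
  with filters chosen separately for each vector, the limits need not form linear operators.\<close>

lemma orbit_subfilter:
  fixes f :: "real \<Rightarrow> 'a complexification \<Rightarrow> 'i \<Rightarrow> 'a complexification"
  assumes "F \<noteq> bot" and "\<And>k z i. f k z i \<in> closure (orbit S z)"
  shows "\<exists>G\<le>F. G \<noteq> bot \<and> (\<forall>k z. \<exists>w\<in>closure (orbit S z). (f k z \<longlongrightarrow> w) G)"
proof -
  have "\<exists>G\<le>F. G \<noteq> bot \<and>
      (\<forall>v. \<exists>w\<in>closure (orbit S (snd v)). (f (fst v) (snd v) \<longlongrightarrow> w) G)"
    by (rule simultaneously_convergent_subfilter) (use assms compact_orbit in auto)
  then show ?thesis by simp
qed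

text \<open>
  \<open>U t = lim\<^sub>k lim\<^sub>l S (l - k + t)\<close> along suitable filters: passing to the limit twice makes
  \<open>U 0\<close> idempotent, so it is the Jacobs--de Leeuw--Glicksberg projection.
\<close>

lemma limit_group_exists:
  obtains U :: "real \<Rightarrow> 'a complexification \<Rightarrow> 'a complexification" where
    "\<And>t. clinear (U t)"
    and "\<And>t z. norm (U t z) \<le> M * norm z"
    and "\<And>s t z. 0 \<le> s \<Longrightarrow> S s (U t z) = U (s + t) z"
    and "\<And>s t z. 0 \<le> s \<Longrightarrow> U t (S s z) = U (s + t) z"
    and "\<And>t z. ((\<lambda>s. S s z) \<longlongrightarrow> 0) at_top \<Longrightarrow> U t z = 0"
    and "\<And>z. ((\<lambda>s. S s (z - U 0 z)) \<longlongrightarrow> 0) at_top"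
    and "\<And>t f. f \<in> positive_cone \<Longrightarrow> U t f \<in> positive_cone"
    and "\<And>B t z. bounded_linear B \<Longrightarrow> \<forall>s\<ge>0. \<forall>z. B (S s z) = S s (B z) \<Longrightarrow> B (U t z) = U t (B z)"
proof -
  \<comment> \<open>A shifted time \<open>l - k\<close> may be negative; \<open>max 0\<close> keeps
    it admissible and does not affect limits at infinity.\<close>
  have "S (max 0 r) z \<in> closure (orbit S z)" for r z
    by (intro set_mp[OF closure_subset]) (auto simp: orbit_def)
  then obtain F where F: "F \<le> at_top" "F \<noteq> bot" and
    "\<forall>k z. \<exists>w\<in>closure (orbit S z). ((\<lambda>l. S (max 0 (l - k)) z) \<longlongrightarrow> w) F"
    using orbit_subfilter[of at_top "\<lambda>k z l. S (max 0 (l - k)) z"] by auto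
  \<comment> \<open>\<open>R k\<close> is the limit at infinity delayed by \<open>k\<close>, a
    substitute for time \<open>- k\<close>; applying \<open>S s\<close> shortens the delay by
    \<open>s\<close>.\<close>
  then obtain R where R: "\<And>k z. R k z \<in> closure (orbit S z)"
    "\<And>k z. ((\<lambda>l. S (max 0 (l - k)) z) \<longlongrightarrow> R k z) F" by metis
  obtain G where G: "G \<le> F" "G \<noteq> bot" and
    "\<forall>t z. \<exists>w\<in>closure (orbit S z). ((\<lambda>k. R (k - t) z) \<longlongrightarrow> w) G"
    using orbit_subfilter[OF F(2), of "\<lambda>t z k. R (k - t) z"] R(1) by auto
  then obtain U where U: "\<And>t z. U t z \<in> closure (orbit S z)"
    "\<And>t z. ((\<lambda>k. R (k - t) z) \<longlongrightarrow> U t z) G" by metis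
  have ge: "eventually (\<lambda>l. c \<le> l) F" "eventually (\<lambda>l. c \<le> l) G" for c
    using filter_leD[OF F(1) eventually_ge_at_top] filter_leD[OF order_trans[OF G(1) F(1)] eventually_ge_at_top]
    by blast+

  have R_unique: "R k z = w" if "((\<lambda>l. S (max 0 (l - k)) z) \<longlongrightarrow> w) F" for k z w
    using tendsto_unique[OF F(2) R(2) that] .
  have U_unique: "U t z = w" if "((\<lambda>k. R (k - t) z) \<longlongrightarrow> w) G" for t z w
    using tendsto_unique[OF G(2) U(2) that] .
  have R_lin: "clinear (R k)" for k
    unfolding clinear_iff
  proof (intro conjI allI)
    fix x y c
    show "R k (x + y) = R k x + R k y"
      using tendsto_add[OF R(2)[of k x] R(2)[of k y]] by (intro R_unique) (simp add: clinear_add lin)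
    show "R k (c *\<^sub>C x) = c *\<^sub>C R k x"
      using tendsto_scaleC[OF tendsto_const R(2)[of k x], of c]
      by (intro R_unique) (simp add: clinear_scaleC lin)
  qed
  have U_lin: "clinear (U t)" for t
    unfolding clinear_iff
  proof (intro conjI allI)
    fix x y c
    show "U t (x + y) = U t x + U t y"
      using tendsto_add[OF U(2)[of t x] U(2)[of t y]] by (intro U_unique) (simp add: clinear_add R_lin)
    show "U t (c *\<^sub>C x) = c *\<^sub>C U t x"
      using tendsto_scaleC[OF tendsto_const U(2)[of t x], of c]
      by (intro U_unique) (simp add: clinear_scaleC R_lin)
  qed
  have U_norm: "norm (U t z) \<le> M * norm z" for t z
    using norm_le_of_mem_closure_orbit[OF U(1)] .
  have S_shift: "S s (S (max 0 (l - k)) z) = S (max 0 (l - (k - s))) z" if "0 \<le> s" "k \<le> l" for s k l z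
    using S_add[of s "l - k" z] that by (simp add: max_def algebra_simps)
  have R_shift: "S s (R k z) = R (k - s) z" if s: "0 \<le> s" for s k z
  proof -
    have "((\<lambda>l. S s (S (max 0 (l - k)) z)) \<longlongrightarrow> S s (R k z)) F"
      by (rule bounded_linear.tendsto[OF bounded_linear_S[OF s] R(2)])
    then have "((\<lambda>l. S (max 0 (l - (k - s))) z) \<longlongrightarrow> S s (R k z)) F"
      by (rule Lim_transform_eventually) (use S_shift[OF s] in \<open>auto intro: eventually_mono[OF ge(1)[of k]]\<close>)
    then show ?thesis by (rule R_unique[symmetric])
  qed
  have R_commute: "B (R k z) = R k (B z)"
    if "bounded_linear B" "\<And>s z. 0 \<le> s \<Longrightarrow> B (S s z) = S s (B z)" for B k z
    using bounded_linear.tendsto[OF that(1) R(2)[of k z]] by (intro R_unique[symmetric]) (simp add: that(2))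
  \<comment> \<open>Used later with one of the \<open>U s\<close> as \<open>B\<close>, this makes
    the limit operators commute without any exchange of limits.\<close>
  have U_commute: "B (U t z) = U t (B z)"
    if "bounded_linear B" "\<forall>s\<ge>0. \<forall>z. B (S s z) = S s (B z)" for B t z
    using bounded_linear.tendsto[OF that(1) U(2)[of t z]]
    by (intro U_unique[symmetric]) (simp add: R_commute that)
  have S_commute: "S s (S t z) = S t (S s z)" if "0 \<le> s" "0 \<le> t" for s t z
    using that by (simp add: S_add add.commute)
  have U_shift: "S s (U t z) = U (s + t) z" if s: "0 \<le> s" for s t z
    using bounded_linear.tendsto[OF bounded_linear_S[OF s] U(2)[of t z]]
    by (intro U_unique[symmetric]) (simp add: R_shift[OF s] algebra_simps)
  have U_S: "U t (S s z) = U (s + t) z" if s: "0 \<le> s" for s t z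
    using U_commute[OF bounded_linear_S[OF s], of t z] S_commute s U_shift[OF s] by simp
  have U_stable: "U t z = 0" if "((\<lambda>s. S s z) \<longlongrightarrow> 0) at_top" for t z
  proof -
    have "R k z = 0" for k
    proof (rule R_unique)
      have "filterlim (\<lambda>l. max 0 (l - k)) at_top at_top"
        unfolding filterlim_at_top eventually_at_top_linorder by (metis add.commute le_diff_eq max.coboundedI2)
      then show "((\<lambda>l. S (max 0 (l - k)) z) \<longlongrightarrow> 0) F"
        using filterlim_mono[OF filterlim_compose[OF that] order_refl F(1)] by blast
    qed
    then show ?thesis by (intro U_unique) simp
  qed
  \<comment> \<open>Along \<open>G\<close>, both \<open>S k z\<close> and \<open>S k (U 0 z)\<close>
    tend to \<open>R 0 z\<close>: the latter because \<open>R 0 z = S k (R k z)\<close>, while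
    \<open>R k z\<close> tends to \<open>U 0 z\<close> and the \<open>S k\<close> are uniformly
    bounded.\<close>
  have stable: "((\<lambda>s. S s (z - U 0 z)) \<longlongrightarrow> 0) at_top" for z
  proof -
    have "((\<lambda>k. M * norm (U 0 z - R k z)) \<longlongrightarrow> 0) G"
      using tendsto_mult_left[OF tendsto_norm_zero[OF LIM_zero[OF U(2)[of 0 z]]], of M]
      by (simp add: norm_minus_commute)
    moreover have "norm (S k (U 0 z) - R 0 z) \<le> M * norm (U 0 z - R k z)" if "0 \<le> k" for k
      using norm_S[OF that, of "U 0 z - R k z"] R_shift[OF that, of k z]
      by (simp add: clinear_diff[OF lin[OF that]])
    ultimately have "((\<lambda>k. S k (U 0 z) - R 0 z) \<longlongrightarrow> 0) G"
      by (intro Lim_null_comparison[where f = "\<lambda>k. S k (U 0 z) - R 0 z"] eventually_mono[OF ge(2)[of 0]]) auto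
    moreover have "((\<lambda>k. S k z - R 0 z) \<longlongrightarrow> 0) G"
    proof -
      have "((\<lambda>k. S k z) \<longlongrightarrow> R 0 z) F"
        by (rule Lim_transform_eventually[OF R(2)[of 0 z]]) (auto intro: eventually_mono[OF ge(1)[of 0]])
      then show ?thesis using tendsto_mono[OF G(1)] LIM_zero by blast
    qed
    ultimately have "((\<lambda>k. (S k z - R 0 z) - (S k (U 0 z) - R 0 z)) \<longlongrightarrow> 0) G"
      using tendsto_diff by fastforce
    then have lim: "((\<lambda>k. S k (z - U 0 z)) \<longlongrightarrow> 0) G"
      by (rule Lim_transform_eventually)
        (auto simp: clinear_diff[OF lin] intro: eventually_mono[OF ge(2)[of 0]])
    \<comment> \<open>Convergence along \<open>G\<close> supplies one small value, and later values
      exceed it by at most the factor \<open>M\<close>. Dividing by \<open>M + 1\<close> also covers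
      \<open>M = 0\<close>.\<close>
    show ?thesis
    proof (rule tendstoI)
      fix e :: real assume "e > 0"
      then have "e / (M + 1) > 0" using M_nonneg by simp
      from eventually_conj[OF tendstoD[OF lim this] ge(2)[of 0]]
      obtain k where k: "norm (S k (z - U 0 z)) < e / (M + 1)" "0 \<le> k"
        using eventually_happens'[OF G(2)] by (metis (no_types, lifting) dist_0_norm dist_commute)
      have "norm (S t (z - U 0 z)) < e" if "k \<le> t" for t
      proof -
        have "norm (S t (z - U 0 z)) \<le> M * norm (S k (z - U 0 z))" using norm_S_le_norm_S k(2) that by blast
        also have "\<dots> \<le> M * (e / (M + 1))" using M_nonneg k(1) by (intro mult_left_mono) auto
        also have "\<dots> < e" using M_nonneg \<open>e > 0\<close> by (simp add: field_simps)
        finally show ?thesis .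
      qed
      then show "\<forall>\<^sub>F t in at_top. dist (S t (z - U 0 z)) 0 < e"
        unfolding eventually_at_top_linorder by (intro exI[of _ k]) simp
    qed
  qed
  \<comment> \<open>\<open>n\<close> stays fixed while time runs to infinity, so a threshold
    depending on \<open>n\<close> and \<open>f\<close> is harmless; then the strong limit in
    \<open>n\<close> removes \<open>P n\<close>. \<open>LEP\<close> speaks of nonzero vectors, hence
    the case distinction.\<close>
  have R_pos: "R k f \<in> positive_cone" if f: "f \<in> positive_cone" for k f
  proof (cases "f = 0")
    case True
    then show ?thesis using clinear_zero[OF R_lin] f by simp
  next
    case False
    have "P n (R k f) \<in> positive_cone" for n
    proof -
      obtain \<tau> where \<tau>: "\<tau> > 0" "\<And>t. t \<ge> \<tau> \<Longrightarrow> P n (S t f) \<in> positive_cone"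
        using LEP f False unfolding LEP_def by blast
      have "eventually (\<lambda>l. P n (S (max 0 (l - k)) f) \<in> positive_cone) F"
        by (rule eventually_mono[OF ge(1)[of "\<tau> + k"]]) (auto intro!: \<tau>(2))
      moreover have "((\<lambda>l. P n (S (max 0 (l - k)) f)) \<longlongrightarrow> P n (R k f)) F"
        by (rule bounded_linear.tendsto[OF positive_operator_bounded_linear[OF P_pos] R(2)])
      ultimately show ?thesis by (rule Lim_in_closed_set[OF closed_positive_cone _ F(2)])
    qed
    then show ?thesis
      by (intro Lim_in_closed_set[OF closed_positive_cone _ trivial_limit_sequentially P_lim]) simp
  qed
  have U_pos: "U t f \<in> positive_cone" if "f \<in> positive_cone" for t f
    by (rule Lim_in_closed_set[OF closed_positive_cone _ G(2) U(2)]) (simp add: R_pos[OF that])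
  show thesis
    by (rule that[of U]) (fact U_lin U_norm U_shift U_S U_stable stable U_pos U_commute)+
qed

theorem eigenvalue_multiple:
  fixes n :: int
  assumes z: "\<And>t. 0 \<le> t \<Longrightarrow> S t z = cis (b * t) *\<^sub>C z" and "z \<noteq> 0"
  shows "\<exists>w. w \<noteq> 0 \<and> (\<forall>t\<ge>0. S t w = cis (of_int n * b * t) *\<^sub>C w)"
proof -
  obtain U where U_lin: "\<And>t. clinear (U t)"
    and U_norm: "\<And>t z. norm (U t z) \<le> M * norm z"
    and U_shift: "\<And>s t z. 0 \<le> s \<Longrightarrow> S s (U t z) = U (s + t) z"
    and U_S: "\<And>s t z. 0 \<le> s \<Longrightarrow> U t (S s z) = U (s + t) z"
    and U_stable: "\<And>t z. ((\<lambda>s. S s z) \<longlongrightarrow> 0) at_top \<Longrightarrow> U t z = 0"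
    and stable: "\<And>z. ((\<lambda>s. S s (z - U 0 z)) \<longlongrightarrow> 0) at_top"
    and U_pos: "\<And>t f. f \<in> positive_cone \<Longrightarrow> U t f \<in> positive_cone"
    and U_commute: "\<And>B t z. bounded_linear B \<Longrightarrow> \<forall>s\<ge>0. \<forall>z. B (S s z) = S s (B z) \<Longrightarrow> B (U t z) = U t (B z)"
    by (rule limit_group_exists) (rule that)
  have U_proj: "U t (U 0 x) = U t x" for t x
    using U_stable[OF stable[of x], of t] by (simp add: clinear_diff[OF U_lin])
  have U_comm: "U s (U t x) = U t (U s x)" for s t x
    using clinear_bounded_linear[OF U_lin U_norm] by (rule U_commute) (simp add: U_shift U_S)
  have U_proj': "U 0 (U t x) = U t x" for t x using U_comm[of 0 t x] U_proj by simp
  have group: "U s (U t x) = U (s + t) x" for s t x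
  proof (cases "0 \<le> s")
    case True
    have "U s (U t x) = S s (U 0 (U t x))" using U_shift[OF True] by simp
    then show ?thesis using U_proj' U_shift[OF True] by simp
  next
    case False
    \<comment> \<open>For negative \<open>s\<close> the defect \<open>d\<close> is annihilated by
      \<open>S (- s)\<close>, hence stable and killed by \<open>U 0\<close>; yet \<open>U 0\<close>
      fixes it.\<close>
    define d where "d = U s (U t x) - U (s + t) x"
    have "S (- s) d = 0"
      using False by (simp add: d_def clinear_diff[OF lin] U_shift U_proj')
    then have "norm (S r d) \<le> 0" if "- s \<le> r" for r
      using norm_S_le_norm_S[of "- s" r d] False that by simp
    then have "eventually (\<lambda>r. S r d = 0) at_top"
      by (intro eventually_mono[OF eventually_ge_at_top[of "- s"]]) simp
    then have "U 0 d = 0" by (intro U_stable tendsto_eventually)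
    moreover have "U 0 d = d" by (simp add: d_def clinear_diff[OF U_lin] U_proj')
    ultimately show ?thesis by (simp add: d_def)
  qed
  have U_op: "positive_operator (U t)" for t
    using U_lin U_pos by (auto simp: positive_operator_def)
  define u where "u t x = re_part (U t (Cpx x 0))" for t x
  have Uu: "U t v = Cpx (u t (re_part v)) (u t (im_part v))" for t v
    using positive_operator_Cpx[OF U_op, of t "re_part v" "im_part v"] by (simp add: u_def)
  interpret positive_group u
  proof
    fix s t r and x y :: 'a
    have "Cpx (x + y) 0 = Cpx x 0 + Cpx y 0" "Cpx (r *\<^sub>R x) 0 = r *\<^sub>R Cpx x 0"
      by (simp_all add: complexification_eq_iff)
    then show "u t (x + y) = u t x + u t y" "u t (r *\<^sub>R x) = r *\<^sub>R u t x"
      by (simp_all add: u_def clinear_add[OF U_lin] clinear_scaleR[OF U_lin])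
    show "0 \<le> u t x" if "0 \<le> x"
      using positive_operator_real(2)[OF U_op that] by (simp add: u_def)
    have "U t (Cpx x 0) = Cpx (u t x) 0"
      using positive_operator_real(1)[OF U_op] by (simp add: u_def complexification_eq_iff)
    then show "u s (u t x) = u (s + t) x"
      using group[of s t "Cpx x 0"] by (simp add: u_def)
  qed
  \<comment> \<open>\<open>U 0 z\<close> obeys the same law as \<open>z\<close>, so the orbit of the
    difference has constant norm; it also tends to zero.\<close>
  have Uz0: "U 0 z = z"
  proof -
    define d where "d = z - U 0 z"
    have "S t (U 0 z) = cis (b * t) *\<^sub>C U 0 z" if "0 \<le> t" for t
      using U_S[OF that, of 0 z] by (simp add: U_shift[OF that] z[OF that] clinear_scaleC[OF U_lin])
    then have "norm (S t d) = norm d" if "0 \<le> t" for t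
      using that by (simp add: d_def clinear_diff[OF lin] z norm_scaleC flip: scaleC_diff_right)
    then have "eventually (\<lambda>t. norm (S t d) = norm d) at_top"
      by (intro eventually_mono[OF eventually_ge_at_top[of 0]])
    from Lim_transform_eventually[OF tendsto_norm_zero[OF stable[of z, folded d_def]] this]
    have "((\<lambda>t :: real. norm d) \<longlongrightarrow> 0) at_top" .
    then show ?thesis by (simp add: d_def tendsto_const_iff)
  qed
  have "Cpx (u t (re_part z)) (u t (im_part z)) = cis (b * t) *\<^sub>C z" for t
  proof (cases "0 \<le> t")
    case True
    then show ?thesis using U_shift[OF True, of 0 z] by (simp add: Uz0 z flip: Uu)
  next
    case False
    then have "U t (S (- t) z) = z" by (simp add: U_S Uz0)
    then have "cis (- (b * t)) *\<^sub>C U t z = z"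
      using False by (simp add: z clinear_scaleC[OF U_lin])
    then have "cis (b * t) *\<^sub>C z = cis (b * t) *\<^sub>C (cis (- (b * t)) *\<^sub>C U t z)" by simp
    then show ?thesis by (simp add: scaleC_scaleC cis_mult flip: Uu)
  qed
  from eigenvector_power[OF this \<open>z \<noteq> 0\<close>, of n]
  obtain w where w: "w \<noteq> 0" "\<And>t. U t w = cis (of_int n * b * t) *\<^sub>C w" by (auto simp: Uu)
  \<comment> \<open>At time zero the law for \<open>w\<close> says \<open>U 0 w = w\<close>, and on
    the range of \<open>U 0\<close> the operators \<open>S t\<close> and \<open>U t\<close>
    agree.\<close>
  have "S t w = cis (of_int n * b * t) *\<^sub>C w" if "0 \<le> t" for t
    using U_shift[OF that, of 0 w] w(2)[of t] w(2)[of 0] by simp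
  then show ?thesis using w(1) by blast
qed

text \<open>
  \<open>v t = e\<^sup>-\<^sup>i\<^sup>b\<^sup>t S t z\<close> satisfies
  \<open>\<parallel>v (N h) - z\<parallel> \<le> N M \<parallel>v h - z\<parallel>\<close> by telescoping, and \<open>v h - z = o(h)\<close>.
\<close>

lemma eigenvector_orbit:
  assumes lim: "((\<lambda>h. (cis (- (b * h)) *\<^sub>C S h z - z) /\<^sub>R h) \<longlongrightarrow> 0) (at_right 0)" and t: "0 \<le> t"
  shows "S t z = cis (b * t) *\<^sub>C z"
proof -
  define v where "v h = cis (- (b * h)) *\<^sub>C S h z" for h
  have step: "norm (v (real N * h) - z) \<le> real N * (M * norm (v h - z))" if h: "0 \<le> h" for N h
  proof (induction N)
    case 0
    then show ?case by (simp add: v_def S_0)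
  next
    case (Suc N)
    have Nh: "0 \<le> real N * h" using h by simp
    have "v (real (Suc N) * h) - v (real N * h) = cis (- (b * (real N * h))) *\<^sub>C S (real N * h) (v h - z)"
      using Nh h
      by (simp add: v_def clinear_diff[OF lin] clinear_scaleC[OF lin] scaleC_diff_right scaleC_scaleC
          cis_mult S_add algebra_simps)
    then have "norm (v (real (Suc N) * h) - v (real N * h)) \<le> M * norm (v h - z)"
      using norm_S[OF Nh] by (simp add: norm_scaleC)
    then show ?case
      using Suc norm_triangle_ineq[of "v (real (Suc N) * h) - v (real N * h)" "v (real N * h) - z"]
      by (simp add: algebra_simps)
  qed
  have "v t = z"
  proof (cases "t = 0")
    case True
    then show ?thesis by (simp add: v_def S_0)
  next
    case False
    then have t: "0 < t" using t by simp
    \<comment> \<open>These step sizes reach \<open>t\<close> exactly after \<open>Suc N\<close>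
      steps, so the telescoped bound equals \<open>t * M\<close> times the norm of a difference
      quotient.\<close>
    have "filterlim (\<lambda>N. t / real (Suc N)) (at_right 0) sequentially"
    proof (rule tendsto_imp_filterlim_at_right)
      show "(\<lambda>N. t / real (Suc N)) \<longlonglongrightarrow> 0"
        using tendsto_mult[OF tendsto_const LIMSEQ_inverse_real_of_nat, of t] by (simp add: field_simps)
    qed (use t in simp)
    from filterlim_compose[OF lim this]
    have "(\<lambda>N. (v (t / real (Suc N)) - z) /\<^sub>R (t / real (Suc N))) \<longlonglongrightarrow> 0" by (simp add: v_def)
    from tendsto_mult[OF tendsto_const tendsto_norm_zero[OF this], of "t * M"]
    have "(\<lambda>N. t * M * norm ((v (t / real (Suc N)) - z) /\<^sub>R (t / real (Suc N)))) \<longlonglongrightarrow> 0" by simp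
    moreover have "norm (v t - z) \<le> t * M * norm ((v (t / real (Suc N)) - z) /\<^sub>R (t / real (Suc N)))" for N
    proof -
      define h where "h = t / real (Suc N)"
      have h: "0 < h" "real (Suc N) * h = t" using t by (simp_all add: h_def)
      have "norm (v t - z) \<le> real (Suc N) * (M * norm (v h - z))"
        using step[of h "Suc N"] h by simp
      also have "\<dots> = t * M * norm ((v h - z) /\<^sub>R h)"
        using h(1) by (simp add: h(2)[symmetric] del: of_nat_Suc)
      finally show ?thesis by (simp only: h_def)
    qed
    ultimately have "norm (v t - z) \<le> 0" by (meson LIMSEQ_le_const)
    then show ?thesis by simp
  qed
  then have "cis (b * t) *\<^sub>C v t = cis (b * t) *\<^sub>C z" by simp
  then show ?thesis by (simp add: v_def scaleC_scaleC cis_mult)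
qed

end

section \<open>The point spectrum of the generator\<close>

lemma exp_quotient_limit:
  fixes c :: complex
  shows "((\<lambda>t::real. (exp (c * of_real t) - 1) / of_real t) \<longlongrightarrow> c) (at_right 0)"
proof (cases "c = 0")
  case False
  have "filterlim (\<lambda>t::real. c * of_real t) (at 0) (at_right 0)"
    using False by (auto simp: filterlim_at eventually_at_filter intro!: tendsto_eq_intros)
  from tendsto_mult[OF tendsto_const filterlim_compose[OF lim_exp_minus_1 this], of c]
  show ?thesis using False by simp
qed simp

lemma scaleC_inverse_real: "(x / of_real t) *\<^sub>C z = (x *\<^sub>C z) /\<^sub>R t"
  by (simp add: complexification_eq_iff divide_inverse algebra_simps flip: of_real_inverse)

text \<open>\<open>Lim\<close> is unspecified where no limit exists, so domain membership and the
  value of the generator are merged into one convergence statement.\<close>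

lemma point_spectrum_iff:
  "\<mu> \<in> point_spectrum (generator_domain T) (generator T) \<longleftrightarrow>
    (\<exists>z. z \<noteq> 0 \<and> ((\<lambda>t. (T t z - z) /\<^sub>R t) \<longlongrightarrow> \<mu> *\<^sub>C z) (at_right 0))"
proof -
  have lim: "generator T z = w" if "((\<lambda>t. (T t z - z) /\<^sub>R t) \<longlongrightarrow> w) (at_right 0)" for z w
    unfolding generator_def using that by (intro tendsto_Lim) simp_all
  show ?thesis
    unfolding point_spectrum_def generator_domain_def using lim by auto
qed

lemma rescaled_eq_scaleC: "rescaled_semigroup s T t z = exp (- of_real (t * s)) *\<^sub>C T t z"
  by (simp add: rescaled_semigroup_def flip: scaleC_of_real exp_of_real of_real_minus of_real_mult)

theorem corollary3p6:
  fixes T :: "real \<Rightarrow> 'a :: banach_lattice complexification \<Rightarrow> 'a complexification"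
    and P :: "nat \<Rightarrow> 'a complexification \<Rightarrow> 'a complexification"
  assumes semigroup: "C0_semigroup T"
    and bound: "spectral_bound (generator_domain T) (generator T) > -\<infinity>"
    and positive: "\<And>n. positive_operator (P n)"
    and increasing: "increasing_operators P"
    and strong_limit: "\<And>z. (\<lambda>n. P n z) \<longlonglongrightarrow> z"
    and LEP: "LEP T P"
    and compact_orbits: "relatively_compact_orbits
      (rescaled_semigroup
        (real_of_ereal (spectral_bound (generator_domain T) (generator T))) T)"
  shows "cyclic (peripheral_point_spectrum (generator_domain T) (generator T))"
  unfolding cyclic_def
proof (intro allI impI)
  fix a b :: real and n :: int
  assume "Complex a b \<in> peripheral_point_spectrum (generator_domain T) (generator T)"
  then have eig: "Complex a b \<in> point_spectrum (generator_domain T) (generator T)"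
    and sb: "spectral_bound (generator_domain T) (generator T) = ereal a"
    by (simp_all add: peripheral_point_spectrum_def)
  \<comment> \<open>By \<open>sb\<close> the spectral bound is the real number \<open>a\<close>, so
    this is the semigroup whose orbits are relatively compact.\<close>
  define S where "S = rescaled_semigroup a T"
  have compact: "compact (closure (orbit S z))" for z
    using compact_orbits by (simp add: S_def sb relatively_compact_orbits_def)
  have T_lin: "clinear (T t)" if "0 \<le> t" for t
    using semigroup that by (simp add: C0_semigroup_def bounded_clinear_def)
  have S_lin: "clinear (S t)" if "0 \<le> t" for t
    unfolding clinear_iff using T_lin[OF that]
    by (simp add: S_def rescaled_semigroup_def clinear_add clinear_scaleC scaleR_add_right
        complexification_eq_iff algebra_simps)
  have S_bl: "bounded_linear (S t)" if t: "0 \<le> t" for t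
  proof -
    obtain K where "\<And>z. norm (T t z) \<le> K * norm z"
      using semigroup t unfolding C0_semigroup_def bounded_clinear_def by meson
    from bounded_linear_compose[OF bounded_linear_scaleR_right clinear_bounded_linear[OF T_lin[OF t] this]]
    show ?thesis unfolding S_def rescaled_semigroup_def .
  qed
  obtain M where M: "M \<ge> 0" "\<And>t z. 0 \<le> t \<Longrightarrow> norm (S t z) \<le> M * norm z"
  proof -
    have "\<exists>B. \<forall>t\<in>{0..}. norm (S t z) \<le> B" for z
    proof -
      have "bounded (orbit S z)"
        using compact_imp_bounded[OF compact] bounded_subset closure_subset by blast
      then show ?thesis by (auto simp: bounded_iff orbit_def)
    qed
    then show thesis
      using uniform_boundedness[of "{0..}" S] S_bl that by auto
  qed
  interpret asymptotically_positive_semigroup S P M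
  proof
    show "S 0 z = z" for z
      using semigroup by (simp add: S_def rescaled_semigroup_def C0_semigroup_def)
    show "S s (S t z) = S (s + t) z" if "0 \<le> s" "0 \<le> t" for s t z
      using semigroup that T_lin[OF that(1)]
      by (simp add: S_def rescaled_semigroup_def C0_semigroup_def clinear_scaleR distrib_right exp_minus exp_add)
    show "LEP S P"
      unfolding LEP_def
    proof (intro allI ballI)
      fix m f assume "f \<in> positive_cone - {0 :: 'a complexification}"
      then obtain \<tau> where \<tau>: "\<tau> > 0" "\<And>t. \<tau> \<le> t \<Longrightarrow> P m (T t f) \<in> positive_cone"
        using LEP unfolding LEP_def by blast
      have "P m (S t f) \<in> positive_cone" if "\<tau> \<le> t" for t
        using \<tau>(2)[OF that] positive[of m]
        by (simp add: S_def rescaled_semigroup_def positive_operator_def clinear_scaleR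
            mem_positive_cone_iff scaleR_nonneg_nonneg)
      then show "\<exists>\<tau>>0. \<forall>t\<ge>\<tau>. P m (S t f) \<in> positive_cone" using \<tau>(1) by blast
    qed
  qed (use S_lin M compact positive strong_limit in auto)

  define \<mu> where "\<mu> = Complex a b"
  obtain z where z: "z \<noteq> 0" and gen: "((\<lambda>t. (T t z - z) /\<^sub>R t) \<longlongrightarrow> \<mu> *\<^sub>C z) (at_right 0)"
    using eig unfolding point_spectrum_iff \<mu>_def by blast
  have cis_S: "cis (- (b * h)) *\<^sub>C S h x = exp (- \<mu> * of_real h) *\<^sub>C T h x" for h x
  proof -
    have "\<mu> * of_real h = of_real (h * a) + \<i> * of_real (b * h)"
      by (simp add: \<mu>_def complex_eq_iff)
    then show ?thesis
      by (simp add: S_def rescaled_eq_scaleC scaleC_scaleC cis_conv_exp add.commute flip: exp_add)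
  qed
  have "S t z = cis (b * t) *\<^sub>C z" if t: "0 \<le> t" for t
  proof (rule eigenvector_orbit[OF _ t])
    have "((\<lambda>t. exp (- \<mu> * of_real t)) \<longlongrightarrow> 1) (at_right 0)"
      by (auto intro!: tendsto_eq_intros)
    \<comment> \<open>Product rule at time zero for e^(- mu t) T(t) z: the contributions mu z and -
      mu z cancel.\<close>
    from tendsto_add[OF tendsto_scaleC[OF this gen] tendsto_scaleC[OF exp_quotient_limit[of "- \<mu>"] tendsto_const[of z]]]
    have "((\<lambda>t. exp (- \<mu> * of_real t) *\<^sub>C ((T t z - z) /\<^sub>R t) +
        ((exp (- \<mu> * of_real t) - 1) / of_real t) *\<^sub>C z) \<longlongrightarrow> 1 *\<^sub>C \<mu> *\<^sub>C z + - \<mu> *\<^sub>C z) (at_right 0)" .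
    moreover have "1 *\<^sub>C \<mu> *\<^sub>C z + - \<mu> *\<^sub>C z = 0" by (simp add: complexification_eq_iff)
    ultimately have "((\<lambda>t. exp (- \<mu> * of_real t) *\<^sub>C ((T t z - z) /\<^sub>R t) +
        ((exp (- \<mu> * of_real t) - 1) / of_real t) *\<^sub>C z) \<longlongrightarrow> 0) (at_right 0)"
      by (simp only:)
    moreover have "exp (- \<mu> * of_real t) *\<^sub>C ((T t z - z) /\<^sub>R t) + ((exp (- \<mu> * of_real t) - 1) / of_real t) *\<^sub>C z
        = (cis (- (b * t)) *\<^sub>C S t z - z) /\<^sub>R t" for t
      unfolding cis_S scaleC_inverse_real by (simp add: complexification_eq_iff algebra_simps)
    ultimately show "((\<lambda>h. (cis (- (b * h)) *\<^sub>C S h z - z) /\<^sub>R h) \<longlongrightarrow> 0) (at_right 0)"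
      by (simp only:)
  qed
  from eigenvalue_multiple[OF this z, of n]
  obtain w where w: "w \<noteq> 0" "\<And>t. 0 \<le> t \<Longrightarrow> S t w = cis (of_int n * b * t) *\<^sub>C w" by blast
  define \<nu> where "\<nu> = Complex a (of_int n * b)"
  have "T t w = exp (\<nu> * of_real t) *\<^sub>C w" if "0 \<le> t" for t
  proof -
    have "T t w = exp (of_real (t * a)) *\<^sub>C S t w"
      by (simp add: S_def rescaled_eq_scaleC scaleC_scaleC flip: exp_add)
    also have "\<dots> = (exp (of_real (t * a)) * cis (of_int n * b * t)) *\<^sub>C w"
      by (simp add: w(2)[OF that] scaleC_scaleC)
    also have "exp (of_real (t * a)) * cis (of_int n * b * t) = exp (\<nu> * of_real t)"
    proof -
      have "\<nu> * of_real t = of_real (t * a) + \<i> * of_real (of_int n * b * t)"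
        by (simp add: \<nu>_def complex_eq_iff)
      then show ?thesis by (simp only: cis_conv_exp exp_add)
    qed
    finally show ?thesis .
  qed
  then have "((exp (\<nu> * of_real t) - 1) / of_real t) *\<^sub>C w = (T t w - w) /\<^sub>R t" if "0 < t" for t
    using that by (simp only: scaleC_inverse_real scaleC_diff_left scaleC_one less_imp_le)
  then have "eventually (\<lambda>t. ((exp (\<nu> * of_real t) - 1) / of_real t) *\<^sub>C w = (T t w - w) /\<^sub>R t) (at_right 0)"
    by (auto simp: eventually_at_filter)
  from Lim_transform_eventually[OF tendsto_scaleC[OF exp_quotient_limit tendsto_const] this]
  have "\<nu> \<in> point_spectrum (generator_domain T) (generator T)"
    unfolding point_spectrum_iff using w(1) by blast
  then show "Complex a (of_int n * b) \<in> peripheral_point_spectrum (generator_domain T) (generator T)"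
    by (simp add: peripheral_point_spectrum_def sb \<nu>_def)
qed

end
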